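(* Suppose the perturbations are intermittent (as defined in the context) and zero-mean, i.e. $\mathbb{E}_t^{\mathcal{G}_i}[\delta_i^{(t)}]=0$ and $\mathbb{E}_t^{\mathcal{H}_{i+1}}[\varepsilon_{i+1}^{(t)}]=0$ for all $t=0,1,\ldots,T-1$ and $i=1,2,\ldots,N-1$. Then, under the loss smoothness, stochasticity, operator regularity and PL assumptions (stated in the context), perturbed SGD (with suitably chosen step size) achieves a convergence rate of $\tilde{\mathcal{O}}(T^{-1})$ provided that $Q_\delta\lesssim 1$ and $Q_\varepsilon\lesssim T$. That is, for every $c>0$ there exist $K>0$, $T_0$ and step sizes $\gamma=\gamma_T>0$ such that for all $T\ge T_0$, whenever the perturbations have magnitude at most $c$ and $Q_\delta\le c$, $Q_\varepsilon\le cT$, one has $\mathbb{E}[\ell(\boldsymbol{w}^{(T)})-\ell^*]\le K\,\frac{\ln T}{T}$.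
   Context: Setting. Let $N\ge 2$, let $d_0,\ldots,d_{N-1},d_{w_1},\ldots,d_{w_N}$ be positive integers and $d_N=1$. For $i=1,\ldots,N$ let $f_i:\mathbb{R}^{d_{i-1}}\times\mathbb{R}^{d_{w_i}}\to\mathbb{R}^{d_i}$ be twice differentiable operators, and let $\mathcal{R}:\mathbb{R}^d\to\mathbb{R}$ be differentiable, where $\boldsymbol{w}=(w_1^\top,\ldots,w_N^\top)^\top\in\mathbb{R}^d$, $d=\sum_i d_{w_i}$. For $x\in\mathbb{R}^{d_0}$ put $y_0=x$, $y_i=f_i(y_{i-1},w_i)$, $\mathcal{F}(x;\boldsymbol{w})=y_N$, $\mathcal{L}(x;\boldsymbol{w})=\mathcal{F}(x;\boldsymbol{w})+\mathcal{R}(\boldsymbol{w})$, and $\ell(\boldsymbol{w})=\mathbb{E}_{x\sim\mathcal{D}}[\mathcal{L}(x;\boldsymbol{w})]$ for a data distribution $\mathcal{D}$. Let $\ell^*=\min_{\boldsymbol{w}}\ell(\boldsymbol{w})$; the initial point $\boldsymbol{w}^{(0)}$ is fixed. $\nabla_1 f_i$ and $\nabla_2 f_i$ denote the Jacobians of $f_i$ with respect to $y_{i-1}$ and $w_i$, and $\nabla^2_{21}f_i\in\mathbb{R}^{d_i\times d_{w_i}\times d_{i-1}}$ is the derivative of $\nabla_2 f_i$ with respect to $y_{i-1}$. Norms. $\|\cdot\|$ is the Euclidean norm for vectors and the Frobenius norm for matrices and tensors; $\|\cdot\|_{\mathrm{op}}$ is the induced operator norm. For $\mathcal{H}\in\mathbb{R}^{p\times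 m\times n}$ and $A\in\mathbb{R}^{m\times n}$, $[\mathcal{H}(A)]_j=\sum_{\alpha,\beta}\mathcal{H}_{j\alpha\beta}A_{\alpha\beta}$ and $\|\mathcal{H}\|_{\mathrm{op}}=\sup_{\|A\|=1}\|\mathcal{H}(A)\|$. Perturbed SGD. For a horizon $T$ and constant step size $\gamma>0$, at iteration $t=0,\ldots,T-1$, with current weights $\boldsymbol{w}^{(t)}$, data sample $x^{(t)}\sim\mathcal{D}$, and random perturbations $\delta_i^{(t)}$ (forward) and $\varepsilon_i^{(t)}$ (backward): $\tilde y_0^{(t)}=x^{(t)}$, $\tilde y_i^{(t)}=f_i(\tilde y_{i-1}^{(t)},w_i^{(t)})+\delta_i^{(t)}$ for $i=1,\ldots,N$; $\tilde v_N^{(t)}=1$, $\tilde v_{i-1}^{(t)}=\nabla_1 f_i(\tilde y_{i-1}^{(t)},w_i^{(t)})^\top\tilde v_i^{(t)}+\varepsilon_i^{(t)}$ for $i=N,\ldots,2$; $\tilde u_i^{(t)}=\nabla_2 f_i(\tilde y_{i-1}^{(t)},w_i^{(t)})^\top\tilde v_i^{(t)}$ for $i=N,\ldots,1$; and $w_i^{(t+1)}=w_i^{(t)}-\gamma(\tilde u_i^{(t)}+r_i^{(t)})$ with $r_i^{(t)}=\nabla_{w_i}\mathcal{R}(\boldsymbol{w}^{(t)})$. Intermittent perturbations. For each $t$ and $i$, either an intermittent forward perturbation occurs, in which case $\delta_i^{(t)}$ is of order $\mathcal{O}(1)$ (i.e. $\|\delta_i^{(t)}\|\le c$ for a constant $c$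 independent of $T$), or $\delta_i^{(t)}=0$; similarly for the backward perturbations $\varepsilon_i^{(t)}$. $Q_\delta$ and $Q_\varepsilon$ denote the total number of perturbation occurrences throughout the optimization (over all iterations and components) in the forward and backward passes, respectively. Filtrations. $\mathcal{F}^{(t)}$ is the filtration generated up to iteration $t$ (so $\boldsymbol{w}^{(t)}$ is $\mathcal{F}^{(t)}$-measurable, while $x^{(t)}$ is a fresh sample from $\mathcal{D}$ independent of $\mathcal{F}^{(t)}$); $\mathcal{G}_i^{(t)}=\sigma(\mathcal{F}^{(t)}\cup\{\tilde y_1^{(t)},\ldots,\tilde y_i^{(t)}\})$; $\mathcal{H}_i^{(t)}=\sigma(\mathcal{G}_N^{(t)}\cup\{\tilde v_N^{(t)},\ldots,\tilde v_i^{(t)}\})$; $\mathbb{E}_t^{\mathcal{G}_i}[\cdot]$, $\mathbb{E}_t^{\mathcal{H}_i}[\cdot]$ are the conditional expectations with respect to $\mathcal{G}_i^{(t)}$, $\mathcal{H}_i^{(t)}$. Notation. $a\lesssim b$ means $a\le cb$ for a constant $c>0$ independent of $T$; $\tilde{\mathcal{O}}$ hides logarithmic dependence on $T$. Loss smoothness assumption. There is $L_{\nabla\ell}>0$ such that $\nabla\ell$ is $L_{\nabla\ell}$-Lipschitz continuous. Stochasticity assumption. There is $\sigma>0$ such that for every $\boldsymbol{w}\in\mathbb{R}^d$, $\mathbb{E}_{x\sim\mathcal{D}}[\nabla_{\boldsymbol{w}}\mathcal{L}(x;\boldsymbol{w})]=\nabla\ell(\boldsymbol{w})$ and $\mathbb{E}_{x\sim\mathcal{D}}[\|\nabla_{\boldsymbol{w}}\mathcal{L}(x;\boldsymbol{w})-\nabla\ell(\boldsymbol{w})\|^2]\le\sigma^2$.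 Operator regularity assumption. There exist constants $C_{\nabla f},C_{\nabla^2 f},L_f,L_{\nabla f},L_{\nabla^2 f}>0$ such that for each $i$ and all $y_{i-1},w_i$: (1) $\|\nabla_j f_i(y_{i-1},w_i)\|_{\mathrm{op}}\le C_{\nabla f}$ for $j=1,2$ and $\|\nabla^2_{21}f_i(y_{i-1},w_i)\|_{\mathrm{op}}\le C_{\nabla^2 f}$; (2) $f_i$ is $L_f$-Lipschitz in $y_{i-1}$ (Euclidean norm); (3) $\nabla f_i$ and $\nabla^2 f_i$ are Lipschitz with respect to both $y_{i-1}$ and $w_i$ with constants $L_{\nabla f}$ and $L_{\nabla^2 f}$ respectively (Frobenius norm). PL assumption. There is $\mu>0$ such that $\|\nabla\ell(\boldsymbol{w})\|^2\ge 2\mu(\ell(\boldsymbol{w})-\ell^* )$ for all $\boldsymbol{w}\in\mathbb{R}^d$.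
   Formalization: The backward zero-mean condition is required given H_{i+1} enlarged by the sample x^(t); without x^(t) the claim fails, as ε may correlate with the first-layer Jacobian. K, T_0, γ are chosen for one fixed type of sample space (removable by passing to the joint law). *)

theory Defs
  imports "HOL-Probability.Probability"
begin

section \<open>Layers\<close>

text \<open>
  All spaces \<open>R^(d 0), \<dots>, R^(d N)\<close> live as coordinate subspaces in one space \<open>real^'y\<close>:
  \<open>lay j\<close> is the layer that owns coordinate \<open>j\<close>, and layer \<open>i\<close> owns \<open>d i\<close> coordinates.
  Likewise \<open>R^d\<close> with \<open>d = d\<^sub>w 1 + \<dots> + d\<^sub>w N\<close> is \<open>real^'w\<close>, and \<open>blk k\<close> is the block to which the
  coordinate \<open>k\<close> of the weight vector belongs. Since \<open>'y\<close> and \<open>'w\<close> are arbitrary finite types,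
  all choices of dimensions are covered.
\<close>

definition index_blocks :: "('n::finite \<Rightarrow> nat) \<Rightarrow> nat set \<Rightarrow> (nat \<Rightarrow> nat) \<Rightarrow> bool" where
  "index_blocks p I d \<longleftrightarrow> range p \<subseteq> I \<and> (\<forall>i\<in>I. card {j. p j = i} = d i)"

definition part :: "('n::finite \<Rightarrow> nat) \<Rightarrow> nat \<Rightarrow> real^'n \<Rightarrow> real^'n" where
  "part p i v = (\<chi> j. if p j = i then v $ j else 0)"

definition block_space :: "('n::finite \<Rightarrow> nat) \<Rightarrow> nat \<Rightarrow> (real^'n) set" where
  "block_space p i = {v. part p i v = v}"

text \<open>
  An operator \<open>R^(d (i-1)) \<times> R^(d\<^sub>w i) \<rightarrow> R^(d i)\<close> is represented by its extension that reads only the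
  coordinates of layer \<open>i - 1\<close> and of weight block \<open>i\<close> and whose values lie in the space of
  layer \<open>i\<close>. Jacobians and derivative tensors are thereby padded with zeros, which changes none
  of their norms.
\<close>

definition layered_operators ::
  "('y::finite \<Rightarrow> nat) \<Rightarrow> ('w::finite \<Rightarrow> nat) \<Rightarrow> nat \<Rightarrow> (nat \<Rightarrow> real^'y \<Rightarrow> real^'w \<Rightarrow> real^'y) \<Rightarrow> bool"
where
  "layered_operators lay blk N f \<longleftrightarrow>
     (\<forall>i\<in>{1..N}. \<forall>y w. f i y w = part lay i (f i (part lay (i - 1) y) (part blk i w)))"

text \<open>The single coordinate of layer \<open>N\<close>, used when \<open>d N = 1\<close>.\<close>

definition out_coord :: "('y::finite \<Rightarrow> nat) \<Rightarrow> nat \<Rightarrow> 'y" where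
  "out_coord lay N = the_elem {j. lay j = N}"


section \<open>Derivatives\<close>

definition grad :: "(real^'n \<Rightarrow> real) \<Rightarrow> real^'n \<Rightarrow> real^'n::finite" where
  "grad g w = (\<chi> k. frechet_derivative g (at w) (axis k 1))"

definition jac1 ::
  "(real^'y \<Rightarrow> real^'w \<Rightarrow> real^'y) \<Rightarrow> real^'y \<Rightarrow> real^'w \<Rightarrow> real^'y::finite^'y" where
  "jac1 g y w = jacobian (\<lambda>y'. g y' w) (at y)"

definition jac2 ::
  "(real^'y \<Rightarrow> real^'w \<Rightarrow> real^'y) \<Rightarrow> real^'y \<Rightarrow> real^'w \<Rightarrow> real^'w::finite^'y::finite" where
  "jac2 g y w = jacobian (\<lambda>w'. g y w') (at w)"

text \<open>
  The derivative of a matrix-valued map as a third-order tensor: entry \<open>(j, \<alpha>, \<beta>)\<close> is the partial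
  derivative of the matrix entry \<open>(j, \<alpha>)\<close> in direction \<open>\<beta>\<close>.
\<close>

definition tensor_deriv ::
  "(real^'n::finite \<Rightarrow> real^'m^'p) \<Rightarrow> real^'n \<Rightarrow> real^'n^'m::finite^'p::finite" where
  "tensor_deriv J x = (\<chi> j \<alpha> \<beta>. frechet_derivative J (at x) (axis \<beta> 1) $ j $ \<alpha>)"

definition tensor_apply ::
  "real^'n::finite^'m::finite^'p::finite \<Rightarrow> real^'n^'m \<Rightarrow> real^'p" where
  "tensor_apply H A = (\<chi> j. \<Sum>\<alpha>\<in>UNIV. \<Sum>\<beta>\<in>UNIV. H $ j $ \<alpha> $ \<beta> * A $ \<alpha> $ \<beta>)"

text \<open>
  \<open>hess a b g y w\<close> below is the derivative, with respect to argument \<open>b\<close>, of the Jacobian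
  with respect to argument \<open>a\<close>.
\<close>

definition hess11 :: "(real^'y \<Rightarrow> real^'w \<Rightarrow> real^'y) \<Rightarrow> real^'y \<Rightarrow> real^'w::finite \<Rightarrow> real^'y::finite^'y^'y"
  where "hess11 g y w = tensor_deriv (\<lambda>y'. jac1 g y' w) y"

definition hess12 :: "(real^'y \<Rightarrow> real^'w \<Rightarrow> real^'y) \<Rightarrow> real^'y \<Rightarrow> real^'w \<Rightarrow> real^'w::finite^'y::finite^'y"
  where "hess12 g y w = tensor_deriv (\<lambda>w'. jac1 g y w') w"

definition hess21 :: "(real^'y \<Rightarrow> real^'w \<Rightarrow> real^'y) \<Rightarrow> real^'y \<Rightarrow> real^'w \<Rightarrow> real^'y::finite^'w::finite^'y"
  where "hess21 g y w = tensor_deriv (\<lambda>y'. jac2 g y' w) y"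

definition hess22 :: "(real^'y \<Rightarrow> real^'w \<Rightarrow> real^'y) \<Rightarrow> real^'y \<Rightarrow> real^'w \<Rightarrow> real^'w::finite^'w^'y::finite"
  where "hess22 g y w = tensor_deriv (\<lambda>w'. jac2 g y w') w"

text \<open>
  Full first and second derivatives. The library norm on \<open>real^'n^'m\<close> (and on iterated such types
  and products of them) is the Frobenius norm of all entries.
\<close>

definition jac :: "(real^'y \<Rightarrow> real^'w \<Rightarrow> real^'y) \<Rightarrow> real^'y \<Rightarrow> real^'w
    \<Rightarrow> (real^'y::finite^'y) \<times> (real^'w::finite^'y)" where
  "jac g y w = (jac1 g y w, jac2 g y w)"

definition hess :: "(real^'y \<Rightarrow> real^'w \<Rightarrow> real^'y) \<Rightarrow> real^'y \<Rightarrow> real^'w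
    \<Rightarrow> (real^'y::finite^'y^'y) \<times> (real^'w::finite^'y^'y) \<times> (real^'y^'w^'y) \<times> (real^'w^'w^'y)" where
  "hess g y w = (hess11 g y w, hess12 g y w, hess21 g y w, hess22 g y w)"

definition twice_differentiable :: "(real^'y::finite \<Rightarrow> real^'w::finite \<Rightarrow> real^'y) \<Rightarrow> bool" where
  "twice_differentiable g \<longleftrightarrow>
     (\<forall>p. (\<lambda>(y, w). g y w) differentiable (at p)) \<and>
     (\<forall>p. (\<lambda>(y, w). jac g y w) differentiable (at p))"


section \<open>Loss and assumptions\<close>

primrec fwd :: "(nat \<Rightarrow> real^'y \<Rightarrow> real^'w \<Rightarrow> real^'y) \<Rightarrow> real^'w \<Rightarrow> real^'y \<Rightarrow> nat \<Rightarrow> real^'y" where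
  "fwd f w x 0 = x"
| "fwd f w x (Suc i) = f (Suc i) (fwd f w x i) w"

definition sample_loss ::
  "('y::finite \<Rightarrow> nat) \<Rightarrow> nat \<Rightarrow> (nat \<Rightarrow> real^'y \<Rightarrow> real^'w \<Rightarrow> real^'y) \<Rightarrow> (real^'w \<Rightarrow> real)
    \<Rightarrow> real^'y \<Rightarrow> real^'w \<Rightarrow> real" where
  "sample_loss lay N f R x w = fwd f w x N $ out_coord lay N + R w"

definition expected_loss ::
  "('y::finite \<Rightarrow> nat) \<Rightarrow> nat \<Rightarrow> (nat \<Rightarrow> real^'y \<Rightarrow> real^'w \<Rightarrow> real^'y) \<Rightarrow> (real^'w \<Rightarrow> real)
    \<Rightarrow> (real^'y) measure \<Rightarrow> real^'w \<Rightarrow> real" where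
  "expected_loss lay N f R D w = (\<integral>x. sample_loss lay N f R x w \<partial>D)"

definition data_distribution :: "('y::finite \<Rightarrow> nat) \<Rightarrow> (real^'y) measure \<Rightarrow> bool" where
  "data_distribution lay D \<longleftrightarrow>
     prob_space D \<and> sets D = sets borel \<and> (AE x in D. x \<in> block_space lay 0)"

definition loss_smoothness :: "(real^'w::finite \<Rightarrow> real) \<Rightarrow> bool" where
  "loss_smoothness l \<longleftrightarrow>
     (\<forall>w. l differentiable (at w)) \<and> (\<exists>L>0. L-lipschitz_on UNIV (grad l))"

definition stochasticity ::
  "'x measure \<Rightarrow> ('x \<Rightarrow> real^'w::finite \<Rightarrow> real) \<Rightarrow> (real^'w \<Rightarrow> real) \<Rightarrow> bool" where
  "stochasticity D loss l \<longleftrightarrow> (\<exists>\<sigma>>0. \<forall>w.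
     integrable D (\<lambda>x. grad (loss x) w) \<and>
     (\<integral>x. grad (loss x) w \<partial>D) = grad l w \<and>
     integrable D (\<lambda>x. (norm (grad (loss x) w - grad l w))\<^sup>2) \<and>
     (\<integral>x. (norm (grad (loss x) w - grad l w))\<^sup>2 \<partial>D) \<le> \<sigma>\<^sup>2)"

definition operator_regularity ::
  "nat \<Rightarrow> (nat \<Rightarrow> real^'y::finite \<Rightarrow> real^'w::finite \<Rightarrow> real^'y) \<Rightarrow> bool" where
  "operator_regularity N f \<longleftrightarrow>
     (\<exists>C1>0. \<exists>C2>0. \<exists>L0>0. \<exists>L1>0. \<exists>L2>0. \<forall>i\<in>{1..N}.
        (\<forall>y w. onorm (\<lambda>h. jac1 (f i) y w *v h) \<le> C1) \<and>
        (\<forall>y w. onorm (\<lambda>h. jac2 (f i) y w *v h) \<le> C1) \<and>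
        (\<forall>y w. onorm (tensor_apply (hess21 (f i) y w)) \<le> C2) \<and>
        (\<forall>w. L0-lipschitz_on UNIV (\<lambda>y. f i y w)) \<and>
        (\<forall>w. L1-lipschitz_on UNIV (\<lambda>y. jac (f i) y w)) \<and>
        (\<forall>y. L1-lipschitz_on UNIV (\<lambda>w. jac (f i) y w)) \<and>
        (\<forall>w. L2-lipschitz_on UNIV (\<lambda>y. hess (f i) y w)) \<and>
        (\<forall>y. L2-lipschitz_on UNIV (\<lambda>w. hess (f i) y w)))"

definition pl_condition :: "(real^'w::finite \<Rightarrow> real) \<Rightarrow> real \<Rightarrow> bool" where
  "pl_condition l lmin \<longleftrightarrow> (\<exists>\<mu>>0. \<forall>w. (norm (grad l w))\<^sup>2 \<ge> 2 * \<mu> * (l w - lmin))"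


section \<open>Perturbed SGD\<close>

text \<open>
  One iteration, with sample \<open>x\<close>, forward perturbations \<open>\<delta> i\<close> (\<open>1 \<le> i \<le> N\<close>) and backward perturbations
  \<open>\<epsilon> i\<close> (\<open>2 \<le> i \<le> N\<close>). The value \<open>pbwd \<dots> 0\<close>, in which \<open>\<epsilon> 1\<close> would occur, is never used.
\<close>

primrec pfwd ::
  "(nat \<Rightarrow> real^'y \<Rightarrow> real^'w \<Rightarrow> real^'y) \<Rightarrow> real^'w \<Rightarrow> real^'y \<Rightarrow> (nat \<Rightarrow> real^'y) \<Rightarrow> nat \<Rightarrow> real^'y" where
  "pfwd f w x \<delta> 0 = x"
| "pfwd f w x \<delta> (Suc i) = f (Suc i) (pfwd f w x \<delta> i) w + \<delta> (Suc i)"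

function pbwd ::
  "('y::finite \<Rightarrow> nat) \<Rightarrow> nat \<Rightarrow> (nat \<Rightarrow> real^'y \<Rightarrow> real^'w::finite \<Rightarrow> real^'y) \<Rightarrow> real^'w \<Rightarrow> real^'y
    \<Rightarrow> (nat \<Rightarrow> real^'y) \<Rightarrow> (nat \<Rightarrow> real^'y) \<Rightarrow> nat \<Rightarrow> real^'y" where
  "pbwd lay N f w x \<delta> \<epsilon> i =
     (if i < N
      then transpose (jac1 (f (Suc i)) (pfwd f w x \<delta> i) w) *v pbwd lay N f w x \<delta> \<epsilon> (Suc i) + \<epsilon> (Suc i)
      else axis (out_coord lay N) 1)"
  by pat_completeness auto
termination
  by (relation "Wellfounded.measure (\<lambda>(lay, N, f, w, x, \<delta>, \<epsilon>, i). N - i)") auto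

declare pbwd.simps [simp del]

definition pgrad ::
  "('y::finite \<Rightarrow> nat) \<Rightarrow> nat \<Rightarrow> (nat \<Rightarrow> real^'y \<Rightarrow> real^'w::finite \<Rightarrow> real^'y) \<Rightarrow> real^'w \<Rightarrow> real^'y
    \<Rightarrow> (nat \<Rightarrow> real^'y) \<Rightarrow> (nat \<Rightarrow> real^'y) \<Rightarrow> nat \<Rightarrow> real^'w" where
  "pgrad lay N f w x \<delta> \<epsilon> i =
     transpose (jac2 (f i) (pfwd f w x \<delta> (i - 1)) w) *v pbwd lay N f w x \<delta> \<epsilon> i"

text \<open>Coordinate \<open>k\<close> belongs to block \<open>blk k\<close>, hence is updated with the vector of that block.\<close>

primrec sgd ::
  "('y::finite \<Rightarrow> nat) \<Rightarrow> ('w::finite \<Rightarrow> nat) \<Rightarrow> nat \<Rightarrow> (nat \<Rightarrow> real^'y \<Rightarrow> real^'w \<Rightarrow> real^'y)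
    \<Rightarrow> (real^'w \<Rightarrow> real) \<Rightarrow> real^'w \<Rightarrow> real \<Rightarrow> (nat \<Rightarrow> real^'y) \<Rightarrow> (nat \<Rightarrow> nat \<Rightarrow> real^'y)
    \<Rightarrow> (nat \<Rightarrow> nat \<Rightarrow> real^'y) \<Rightarrow> nat \<Rightarrow> real^'w" where
  "sgd lay blk N f R w0 \<gamma> x \<delta> \<epsilon> 0 = w0"
| "sgd lay blk N f R w0 \<gamma> x \<delta> \<epsilon> (Suc t) =
     (let w = sgd lay blk N f R w0 \<gamma> x \<delta> \<epsilon> t
      in \<chi> k. w $ k - \<gamma> * (pgrad lay N f w (x t) (\<delta> t) (\<epsilon> t) (blk k) $ k + grad R w $ k))"


section \<open>Randomness\<close>

text \<open>
  In the following the sample \<open>x t\<close> and the perturbations \<open>\<delta> t i\<close>, \<open>\<epsilon> t i\<close> are random vectors on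
  a probability space \<open>M\<close>.
\<close>

definition past_sigma ::
  "'a measure \<Rightarrow> nat \<Rightarrow> (nat \<Rightarrow> 'a \<Rightarrow> real^'y::finite) \<Rightarrow> (nat \<Rightarrow> nat \<Rightarrow> 'a \<Rightarrow> real^'y)
    \<Rightarrow> (nat \<Rightarrow> nat \<Rightarrow> 'a \<Rightarrow> real^'y) \<Rightarrow> nat \<Rightarrow> 'a measure" where
  "past_sigma M N x \<delta> \<epsilon> t = sigma (space M)
     ({x s -` A \<inter> space M | s A. s < t \<and> A \<in> sets borel} \<union>
      {\<delta> s i -` A \<inter> space M | s i A. s < t \<and> i \<in> {1..N} \<and> A \<in> sets borel} \<union>
      {\<epsilon> s i -` A \<inter> space M | s i A. s < t \<and> i \<in> {2..N} \<and> A \<in> sets borel})"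

definition extend_sigma ::
  "'a measure \<Rightarrow> nat set \<Rightarrow> (nat \<Rightarrow> 'a \<Rightarrow> 'b::topological_space) \<Rightarrow> 'a measure" where
  "extend_sigma F I Z = sigma (space F) (sets F \<union> {Z k -` A \<inter> space F | k A. k \<in> I \<and> A \<in> sets borel})"

text \<open>
  The families \<open>G\<close> and \<open>H\<close> for iteration \<open>t\<close>; here \<open>W t\<close> denotes the current weights and \<open>F\<close> the
  \<open>\<sigma>\<close>-algebra of the past. The sample \<open>x t\<close> (which is the forward value at layer 0) is
  added before the backward pass, because the backward pass is run with the sample known:
  if a backward perturbation were allowed to depend on the part of \<open>x t\<close> that is not determined by
  the values at layers \<open>1, \<dots>, N\<close>, it could be correlated with the Jacobian of layer 1
  and the gradient estimate would be biased.
\<close>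

definition fwd_sigma ::
  "'a measure \<Rightarrow> (nat \<Rightarrow> real^'y::finite \<Rightarrow> real^'w \<Rightarrow> real^'y) \<Rightarrow> (nat \<Rightarrow> 'a \<Rightarrow> real^'w)
    \<Rightarrow> (nat \<Rightarrow> 'a \<Rightarrow> real^'y) \<Rightarrow> (nat \<Rightarrow> nat \<Rightarrow> 'a \<Rightarrow> real^'y) \<Rightarrow> nat \<Rightarrow> nat \<Rightarrow> 'a measure" where
  "fwd_sigma F f W x \<delta> t i =
     extend_sigma F {1..i} (\<lambda>k \<omega>. pfwd f (W t \<omega>) (x t \<omega>) (\<lambda>j. \<delta> t j \<omega>) k)"

definition bwd_sigma ::
  "'a measure \<Rightarrow> ('y::finite \<Rightarrow> nat) \<Rightarrow> nat \<Rightarrow> (nat \<Rightarrow> real^'y \<Rightarrow> real^'w::finite \<Rightarrow> real^'y)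
    \<Rightarrow> (nat \<Rightarrow> 'a \<Rightarrow> real^'w) \<Rightarrow> (nat \<Rightarrow> 'a \<Rightarrow> real^'y) \<Rightarrow> (nat \<Rightarrow> nat \<Rightarrow> 'a \<Rightarrow> real^'y)
    \<Rightarrow> (nat \<Rightarrow> nat \<Rightarrow> 'a \<Rightarrow> real^'y) \<Rightarrow> nat \<Rightarrow> nat \<Rightarrow> 'a measure" where
  "bwd_sigma F lay N f W x \<delta> \<epsilon> t i =
     extend_sigma (extend_sigma (fwd_sigma F f W x \<delta> t N) {t} x) {i..N}
       (\<lambda>k \<omega>. pbwd lay N f (W t \<omega>) (x t \<omega>) (\<lambda>j. \<delta> t j \<omega>) (\<lambda>j. \<epsilon> t j \<omega>) k)"

definition cond_mean_zero ::
  "'a measure \<Rightarrow> 'a measure \<Rightarrow> ('a \<Rightarrow> real^'n::finite) \<Rightarrow> bool" where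
  "cond_mean_zero M G Z \<longleftrightarrow> (\<forall>j. AE \<omega> in M. real_cond_exp M G (\<lambda>\<omega>. Z \<omega> $ j) \<omega> = 0)"

definition sgd_randomness ::
  "'a measure \<Rightarrow> (real^'y) measure \<Rightarrow> ('y::finite \<Rightarrow> nat) \<Rightarrow> nat \<Rightarrow> nat \<Rightarrow> (nat \<Rightarrow> 'a \<Rightarrow> real^'y)
    \<Rightarrow> (nat \<Rightarrow> nat \<Rightarrow> 'a \<Rightarrow> real^'y) \<Rightarrow> (nat \<Rightarrow> nat \<Rightarrow> 'a \<Rightarrow> real^'y) \<Rightarrow> bool" where
  "sgd_randomness M D lay N T x \<delta> \<epsilon> \<longleftrightarrow>
     prob_space M \<and>
     (\<forall>t<T. x t \<in> borel_measurable M \<and> distr M borel (x t) = D \<and>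
        prob_space.indep_set M (sets (past_sigma M N x \<delta> \<epsilon> t))
          {x t -` A \<inter> space M | A. A \<in> sets borel}) \<and>
     (\<forall>t<T. \<forall>i\<in>{1..N}. \<delta> t i \<in> borel_measurable M \<and> (\<forall>\<omega>\<in>space M. \<delta> t i \<omega> \<in> block_space lay i)) \<and>
     (\<forall>t<T. \<forall>i\<in>{2..N}. \<epsilon> t i \<in> borel_measurable M \<and> (\<forall>\<omega>\<in>space M. \<epsilon> t i \<omega> \<in> block_space lay (i - 1)))"

text \<open>
  The forward perturbation \<open>\<delta> t i\<close> is required to be centred given what is known before it is
  added, that is given \<open>G (i - 1)\<close>. This is implied by centredness given the larger \<open>G i\<close>
  (see \<open>cond_mean_zero_subalgebra\<close> below). The latter would be degenerate as a hypothesis: for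
  \<open>i \<ge> 2\<close> the vector \<open>\<delta> t i\<close> is \<open>G i\<close>-measurable, being the difference of the forward value at
  layer \<open>i\<close> and \<open>f i\<close> at the forward value at layer \<open>i - 1\<close>, hence would vanish almost surely.
  For the backward perturbation, \<open>H (i + 1)\<close> is already the information before \<open>\<epsilon> t (i + 1)\<close> is
  added.
\<close>

definition zero_mean_perturbations ::
  "'a measure \<Rightarrow> ('y::finite \<Rightarrow> nat) \<Rightarrow> nat \<Rightarrow> (nat \<Rightarrow> real^'y \<Rightarrow> real^'w::finite \<Rightarrow> real^'y)
    \<Rightarrow> nat \<Rightarrow> (nat \<Rightarrow> 'a \<Rightarrow> real^'w) \<Rightarrow> (nat \<Rightarrow> 'a \<Rightarrow> real^'y) \<Rightarrow> (nat \<Rightarrow> nat \<Rightarrow> 'a \<Rightarrow> real^'y)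
    \<Rightarrow> (nat \<Rightarrow> nat \<Rightarrow> 'a \<Rightarrow> real^'y) \<Rightarrow> bool" where
  "zero_mean_perturbations M lay N f T W x \<delta> \<epsilon> \<longleftrightarrow>
     (\<forall>t<T. \<forall>i\<in>{1..N-1}.
        cond_mean_zero M (fwd_sigma (past_sigma M N x \<delta> \<epsilon> t) f W x \<delta> t (i - 1)) (\<delta> t i) \<and>
        cond_mean_zero M (bwd_sigma (past_sigma M N x \<delta> \<epsilon> t) lay N f W x \<delta> \<epsilon> t (i + 1)) (\<epsilon> t (i + 1)))"

lemma cond_mean_zero_subalgebra:
  assumes M: "prob_space M" and HM: "subalgebra M H" and GH: "subalgebra H G"
    and Z: "integrable M Z" and zero: "cond_mean_zero M H Z"
  shows "cond_mean_zero M G Z"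
  unfolding cond_mean_zero_def
proof
  fix j
  have GM: "subalgebra M G"
    using HM GH by (auto simp: subalgebra_def)
  interpret M: prob_space M by (fact M)
  interpret G: finite_measure_subalgebra M G
    by unfold_locales (fact GM)
  have Zj: "integrable M (\<lambda>\<omega>. Z \<omega> $ j)"
    by (rule integrable_bounded_linear[OF bounded_linear_vec_nth Z])
  have "AE \<omega> in M. real_cond_exp M G (real_cond_exp M H (\<lambda>\<omega>. Z \<omega> $ j)) \<omega>
      = real_cond_exp M G (\<lambda>\<omega>. Z \<omega> $ j) \<omega>"
    by (rule G.real_cond_exp_nested_subalg[OF HM GH Zj])
  moreover have "AE \<omega> in M. real_cond_exp M G (real_cond_exp M H (\<lambda>\<omega>. Z \<omega> $ j)) \<omega>
      = real_cond_exp M G (\<lambda>\<omega>. 0) \<omega>"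
    using zero by (intro G.real_cond_exp_cong) (auto simp: cond_mean_zero_def)
  moreover have "AE \<omega> in M. real_cond_exp M G (\<lambda>\<omega>. 0) \<omega> = 0"
    by (rule G.real_cond_exp_F_meas) auto
  ultimately show "AE \<omega> in M. real_cond_exp M G (\<lambda>\<omega>. Z \<omega> $ j) \<omega> = 0"
    by eventually_elim simp
qed

text \<open>
  The perturbations are bounded by \<open>c\<close>, and an occurrence is a pair \<open>(t, i)\<close> with nonzero
  perturbation. Occurrences may be random; they are counted along almost every path.
\<close>

definition perturbation_bound ::
  "'a measure \<Rightarrow> nat \<Rightarrow> nat \<Rightarrow> (nat \<Rightarrow> nat \<Rightarrow> 'a \<Rightarrow> real^'y::finite)
    \<Rightarrow> (nat \<Rightarrow> nat \<Rightarrow> 'a \<Rightarrow> real^'y) \<Rightarrow> real \<Rightarrow> bool" where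
  "perturbation_bound M N T \<delta> \<epsilon> c \<longleftrightarrow>
     (AE \<omega> in M. (\<forall>t<T. \<forall>i\<in>{1..N}. norm (\<delta> t i \<omega>) \<le> c) \<and>
                  (\<forall>t<T. \<forall>i\<in>{2..N}. norm (\<epsilon> t i \<omega>) \<le> c))"

definition occurrences ::
  "nat set \<Rightarrow> nat \<Rightarrow> (nat \<Rightarrow> nat \<Rightarrow> 'a \<Rightarrow> real^'y::finite) \<Rightarrow> 'a \<Rightarrow> nat" where
  "occurrences I T \<delta> \<omega> = card {(t, i). t < T \<and> i \<in> I \<and> \<delta> t i \<omega> \<noteq> 0}"

end

(*
  With e the update direction computed by perturbed SGD, write e = G + n + a + b, where G is the
  gradient of the expected loss at the current weights, n the sampling noise, a the effect of the
  forward perturbations alone and b the additional effect of the backward perturbations. The noise n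
  is uncorrelated with G because the sample is fresh. The backward pass is affine in the
  backward perturbations, with coefficients determined by the forward pass, so b is uncorrelated
  with G as well and contributes only to the variance; this is why order T many backward
  perturbations are harmless. The term a is a genuine bias, bounded by a multiple of the sum of the
  norms of the forward perturbations, so its squares summed over all iterations stay bounded when
  there are boundedly many of them. Smoothness and the PL condition yield,
  for the excess loss Delta(t) at iteration t,
    E Delta(t+1) <= (1 - gamma mu / 2) E Delta(t) + gamma E |a|^2 + O(gamma^2),
  and gamma = 2 ln T / (mu T) gives the rate.
*)
theory Submission
  imports Defs
begin

section \<open>Gradients and descent\<close>

text \<open>The error terms telescope: unperturbed pass, forward perturbations only, then both. The
  order matters. The forward error is measured at zero backward perturbation, where the backward
  values are products of Jacobians applied to a unit vector and hence bounded uniformly in weights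
  and sample. The backward error compares two backward passes over the same forward values, so the
  Jacobians agree and only a linear recursion remains. Two obstacles shape the probabilistic part. A
  backward perturbation is centred only conditionally and layer by layer, so Jacobians are moved to
  the other side of the inner product one layer at a time. And the gradient of the loss is
  unbounded, so no expectation of a product with it makes sense before its square integrability is
  known; this is carried along the iterations by induction. The step size is the one with
  \<open>\<gamma> * \<mu> / 2 = ln T / T\<close>: the T contractions shrink the initial excess to at
  most 1/T, and every other term keeps a factor \<open>\<gamma>\<close>.\<close>

lemma norm_transpose_mult_le:
  fixes A :: "real^'n^'m"
  assumes "onorm (\<lambda>h. A *v h) \<le> B"
  shows "norm (transpose A *v v) \<le> B * norm v"
proof (cases "transpose A *v v = 0")
  case True
  have "0 \<le> onorm (\<lambda>h. A *v h)"
    by (rule onorm_pos_le) simp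
  then show ?thesis
    using True assms by simp
next
  case False
  let ?u = "transpose A *v v"
  \<comment> \<open>Pairing the transposed image with itself moves the estimate from the transpose
    to \<open>A\<close>. The regularity assumption bounds the Jacobians, whereas the backward pass
    applies their transposes.\<close>
  have "norm ?u * norm ?u = ?u \<bullet> ?u"
    by (simp add: dot_square_norm power2_eq_square)
  also have "\<dots> = v \<bullet> (A *v ?u)"
    by (simp add: dot_lmul_matrix transpose_matrix_vector inner_commute)
  also have "\<dots> \<le> norm v * norm (A *v ?u)"
    by (rule norm_cauchy_schwarz)
  also have "\<dots> \<le> norm v * (B * norm ?u)"
  proof (intro mult_left_mono)
    have "norm (A *v ?u) \<le> onorm (\<lambda>h. A *v h) * norm ?u"
      by (rule onorm) simp
    also have "\<dots> \<le> B * norm ?u"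
      by (rule mult_right_mono[OF assms norm_ge_zero])
    finally show "norm (A *v ?u) \<le> B * norm ?u" .
  qed simp
  finally have "norm ?u * norm ?u \<le> (B * norm v) * norm ?u"
    by (simp add: ac_simps)
  then show ?thesis
    using False by simp
qed

text \<open>Links the two norms of the regularity assumption: Jacobians are Lipschitz in the
  Frobenius norm, but their differences act on vectors.\<close>

lemma onorm_matrix_le_norm:
  fixes A :: "real^'n^'m"
  shows "onorm (\<lambda>h. A *v h) \<le> norm A"
proof (rule onorm_le)
  fix h :: "real^'n"
  have "norm (A *v h) = L2_set (\<lambda>i. norm ((A *v h) $ i)) UNIV"
    by (simp add: norm_vec_def)
  also have "\<dots> \<le> L2_set (\<lambda>i. norm (A $ i) * norm h) UNIV"
    by (rule L2_set_mono) (auto simp: matrix_vector_mul_component Cauchy_Schwarz_ineq2)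
  also have "\<dots> = norm A * norm h"
    by (simp add: norm_vec_def L2_set_left_distrib)
  finally show "norm (A *v h) \<le> norm A * norm h" .
qed

lemma transpose_diff: "transpose (A - B) = transpose A - transpose (B :: 'a::ab_group_add^'n^'m)"
  by (simp add: transpose_def vec_eq_iff)

lemma jac_component_diff:
  fixes g :: "real^'y \<Rightarrow> real^'w \<Rightarrow> real^'y"
  assumes "L-lipschitz_on UNIV (\<lambda>y. jac g y w)"
  shows "norm (jac1 g y w - jac1 g y' w) \<le> L * norm (y - y')"
    and "norm (jac2 g y w - jac2 g y' w) \<le> L * norm (y - y')"
proof -
  have "dist (jac g y w) (jac g y' w) \<le> L * norm (y - y')"
    using lipschitz_onD[OF assms, of y y'] by (simp add: dist_norm)
  then show "norm (jac1 g y w - jac1 g y' w) \<le> L * norm (y - y')"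
    and "norm (jac2 g y w - jac2 g y' w) \<le> L * norm (y - y')"
    using dist_fst_le[of "jac g y w" "jac g y' w"] dist_snd_le[of "jac g y w" "jac g y' w"]
    by (auto simp: jac_def dist_norm)
qed

lemma grad_has_derivative:
  assumes "g differentiable (at w)"
  shows "(g has_derivative (\<lambda>h. grad g w \<bullet> h)) (at w)"
proof -
  have D: "(g has_derivative frechet_derivative g (at w)) (at w)"
    using assms frechet_derivative_works by blast
  have "frechet_derivative g (at w) h = grad g w \<bullet> h" for h
  proof -
    have "frechet_derivative g (at w) h = frechet_derivative g (at w) (\<Sum>k\<in>UNIV. h $ k *\<^sub>R axis k 1)"
      using basis_expansion[of h] by (simp add: scalar_mult_eq_scaleR)
    also have "\<dots> = grad g w \<bullet> h"
      using has_derivative_linear[OF D]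
      by (simp add: linear_sum linear_cmul grad_def inner_vec_def mult.commute)
    finally show ?thesis .
  qed
  then have "frechet_derivative g (at w) = (\<lambda>h. grad g w \<bullet> h)"
    by blast
  with D show ?thesis
    by simp
qed

lemma grad_eqI:
  assumes "(g has_derivative (\<lambda>h. v \<bullet> h)) (at w)"
  shows "grad g w = v"
  using frechet_derivative_at[OF assms, symmetric] by (simp add: grad_def vec_eq_iff inner_axis)

lemma borel_measurable_vec:
  fixes f :: "'a \<Rightarrow> real^'n"
  assumes "\<And>k. (\<lambda>x. f x $ k) \<in> borel_measurable M"
  shows "f \<in> borel_measurable M"
  using assms by (subst borel_measurable_euclidean_space) (auto simp: Basis_vec_def inner_axis)

text \<open>The gradient of a differentiable function is a pointwise limit of difference quotients.\<close>

lemma borel_measurable_grad: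
  fixes g :: "real^'n \<Rightarrow> real"
  assumes "\<And>w. g differentiable (at w)"
  shows "grad g \<in> borel_measurable borel"
proof (rule borel_measurable_vec)
  fix k
  have cont: "continuous_on UNIV g"
    using assms by (simp add: continuous_at_imp_continuous_on differentiable_imp_continuous_within)
  have gm [measurable]: "g \<in> borel_measurable borel"
    using cont by (rule borel_measurable_continuous_onI)
  show "(\<lambda>w. grad g w $ k) \<in> borel_measurable borel"
  proof (rule borel_measurable_LIMSEQ_real)
    fix w :: "real^'n"
    let ?e = "\<lambda>n. inverse (real (Suc n))"
    have "((\<lambda>t. g (w + t *\<^sub>R axis k 1)) has_real_derivative grad g w $ k) (at 0)"
    proof -
      have "((\<lambda>t::real. w + t *\<^sub>R axis k 1) has_derivative (\<lambda>t. t *\<^sub>R axis k 1)) (at 0)"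
        by (auto intro!: derivative_eq_intros)
      from has_derivative_compose[OF this, of g "\<lambda>h. grad g w \<bullet> h"] grad_has_derivative[OF assms, of w]
      have "((\<lambda>t. g (w + t *\<^sub>R axis k 1)) has_derivative (\<lambda>t. t * grad g w $ k)) (at 0)"
        by (simp add: inner_axis)
      moreover have "(\<lambda>t. t * grad g w $ k) = (*) (grad g w $ k)"
        by (rule ext) (rule mult.commute)
      ultimately show ?thesis
        by (simp add: has_field_derivative_def)
    qed
    then have lim: "((\<lambda>t. (g (w + t *\<^sub>R axis k 1) - g w) / t) \<longlongrightarrow> grad g w $ k) (at 0)"
      by (simp add: DERIV_def)
    have "filterlim ?e (at 0) sequentially"
      unfolding filterlim_at using LIMSEQ_inverse_real_of_nat by auto
    from filterlim_compose[OF lim this]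
    show "(\<lambda>n. (g (w + ?e n *\<^sub>R axis k 1) - g w) / ?e n) \<longlonglongrightarrow> grad g w $ k" .
  qed measurable
qed

text \<open>The mean value theorem on the segment from \<open>w\<close> to \<open>w + h\<close>
  gives the constant \<open>L\<close> in place of the sharp \<open>L / 2\<close>, because the
  gradient at the intermediate point is compared over the whole length of \<open>h\<close>. Only a
  constant is lost.\<close>

lemma descent_lemma:
  assumes diff: "\<And>w. l differentiable (at w)" and lip: "L-lipschitz_on UNIV (grad l)"
  shows "l (w + h) \<le> l w + grad l w \<bullet> h + L * (norm h)\<^sup>2"
proof -
  have L: "0 \<le> L"
    using lip by (rule lipschitz_on_nonneg)
  have "\<exists>u\<in>{0<..<1::real}. l (w + 1 *\<^sub>R h) - l (w + 0 *\<^sub>R h) = (\<lambda>s. grad l (w + u *\<^sub>R h) \<bullet> (s *\<^sub>R h)) (1 - 0)"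
  proof (rule mvt_simple)
    fix u :: real
    have "((\<lambda>s::real. w + s *\<^sub>R h) has_derivative (\<lambda>s. s *\<^sub>R h)) (at u)"
      by (auto intro!: derivative_eq_intros)
    from has_derivative_compose[OF this grad_has_derivative[OF diff]]
    show "((\<lambda>s. l (w + s *\<^sub>R h)) has_derivative (\<lambda>s. grad l (w + u *\<^sub>R h) \<bullet> (s *\<^sub>R h)))
        (at u within {0..1})"
      by (rule has_derivative_at_withinI)
  qed simp
  then obtain u where u: "u \<in> {0<..<1}" and eq: "l (w + h) - l w = grad l (w + u *\<^sub>R h) \<bullet> h"
    by auto
  have "(grad l (w + u *\<^sub>R h) - grad l w) \<bullet> h \<le> norm (grad l (w + u *\<^sub>R h) - grad l w) * norm h"
    by (rule norm_cauchy_schwarz)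
  also have "\<dots> \<le> (L * norm (u *\<^sub>R h)) * norm h"
    using lipschitz_onD[OF lip, of "w + u *\<^sub>R h" w] by (intro mult_right_mono) (auto simp: dist_norm)
  also have "\<dots> \<le> (L * norm h) * norm h"
    using u L by (intro mult_right_mono mult_left_mono) (auto simp: mult_left_le_one_le)
  finally show ?thesis
    using eq by (simp add: inner_diff_left power2_eq_square)
qed

text \<open>The two error terms are treated differently. The constant \<open>e\<close> sums to a
  geometric series, with \<open>e / q\<close> the fixed point of
  \<open>s \<mapsto> (1 - q) * s + e\<close>. The terms \<open>b t\<close> are added without
  discount, which suffices when their total is small although a single one may be large.\<close>

lemma linear_recursion_bound:
  fixes a b :: "nat \<Rightarrow> real"
  assumes step: "\<And>t. t < T \<Longrightarrow> a (Suc t) \<le> (1 - q) * a t + b t + e"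
    and q: "0 < q" "q \<le> 1" and b: "\<And>t. 0 \<le> b t" and "0 \<le> e"
  shows "t \<le> T \<Longrightarrow> a t \<le> (1 - q) ^ t * a 0 + (\<Sum>s<t. b s) + e / q"
proof (induction t)
  case 0
  then show ?case using assms by simp
next
  case (Suc t)
  have "0 \<le> (\<Sum>s<t. b s)"
    using b by (intro sum_nonneg) auto
  then have "(1 - q) * (\<Sum>s<t. b s) \<le> (\<Sum>s<t. b s)"
    using q by (intro mult_left_le_one_le) auto
  moreover have "(1 - q) * (e / q) + e = e / q"
    using q by (simp add: field_simps)
  moreover have "(1 - q) * a t \<le> (1 - q) * ((1 - q) ^ t * a 0 + (\<Sum>s<t. b s) + e / q)"
    using Suc q by (intro mult_left_mono) auto
  ultimately show ?case
    using step[of t] Suc.prems by (simp add: algebra_simps)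
qed

section \<open>Backpropagation in a perturbed network\<close>

text \<open>\<open>jac1\<close> and \<open>jac2\<close> are defined through the partial maps, but in
  the chain rule both arguments of a layer move with the weights. The joint derivative is split
  along the two axes, and uniqueness of derivatives identifies its restrictions with the partial
  Jacobians.\<close>

lemma twice_differentiableD:
  assumes "twice_differentiable g"
  shows twice_differentiable_continuous: "continuous_on UNIV (\<lambda>p. g (fst p) (snd p))"
    and twice_differentiable_continuous_jac1: "continuous_on UNIV (\<lambda>p. jac1 g (fst p) (snd p))"
    and twice_differentiable_continuous_jac2: "continuous_on UNIV (\<lambda>p. jac2 g (fst p) (snd p))"
    and twice_differentiable_has_derivative:
      "((\<lambda>p. g (fst p) (snd p)) has_derivative (\<lambda>h. jac1 g y w *v fst h + jac2 g y w *v snd h)) (at (y, w))"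
proof -
  let ?g = "\<lambda>p. g (fst p) (snd p)" and ?j = "\<lambda>p. jac g (fst p) (snd p)"
  have d: "(\<forall>p. ?g differentiable (at p)) \<and> (\<forall>p. ?j differentiable (at p))"
    using assms unfolding twice_differentiable_def case_prod_beta' .
  have dg: "?g differentiable (at p)" and dj: "?j differentiable (at p)" for p
    by (rule spec[OF conjunct1[OF d]], rule spec[OF conjunct2[OF d]])
  show "continuous_on UNIV ?g"
    using dg by (simp add: continuous_at_imp_continuous_on differentiable_imp_continuous_within)
  have cj: "continuous_on UNIV ?j"
    using dj by (simp add: continuous_at_imp_continuous_on differentiable_imp_continuous_within)
  show "continuous_on UNIV (\<lambda>p. jac1 g (fst p) (snd p))"
    using continuous_on_fst[OF cj] by (simp add: jac_def)
  show "continuous_on UNIV (\<lambda>p. jac2 g (fst p) (snd p))"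
    using continuous_on_snd[OF cj] by (simp add: jac_def)
  obtain G where G: "(?g has_derivative G) (at (y, w))"
    using dg[of "(y, w)"] by (auto simp: differentiable_def)
  have "((\<lambda>y'. (y', w)) has_derivative (\<lambda>h. (h, 0))) (at y)"
    by (auto intro!: derivative_eq_intros)
  from has_derivative_compose[OF this, of ?g G] G
  have G1: "((\<lambda>y'. g y' w) has_derivative (\<lambda>h. G (h, 0))) (at y)"
    by simp
  have "(\<lambda>h. jac1 g y w *v h) = (\<lambda>h. G (h, 0))"
  proof (rule has_derivative_unique[OF _ G1])
    show "((\<lambda>y'. g y' w) has_derivative (\<lambda>h. jac1 g y w *v h)) (at y)"
      unfolding jac1_def using differentiableI[OF G1] by (rule jacobian_works[THEN iffD1])
  qed
  then have j1: "jac1 g y w *v h = G (h, 0)" for h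
    by (rule fun_cong)
  have "((\<lambda>w'. (y, w')) has_derivative (\<lambda>h. (0, h))) (at w)"
    by (auto intro!: derivative_eq_intros)
  from has_derivative_compose[OF this, of ?g G] G
  have G2: "((\<lambda>w'. g y w') has_derivative (\<lambda>h. G (0, h))) (at w)"
    by simp
  have "(\<lambda>h. jac2 g y w *v h) = (\<lambda>h. G (0, h))"
  proof (rule has_derivative_unique[OF _ G2])
    show "((\<lambda>w'. g y w') has_derivative (\<lambda>h. jac2 g y w *v h)) (at w)"
      unfolding jac2_def using differentiableI[OF G2] by (rule jacobian_works[THEN iffD1])
  qed
  then have j2: "jac2 g y w *v h = G (0, h)" for h
    by (rule fun_cong)
  have "G h = jac1 g y w *v fst h + jac2 g y w *v snd h" for h
  proof -
    have split: "(fst h, 0) + (0, snd h) = h"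
      by simp
    show ?thesis
      using linear_add[OF has_derivative_linear[OF G], of "(fst h, 0)" "(0, snd h)"] unfolding split j1 j2 .
  qed
  then have "G = (\<lambda>h. jac1 g y w *v fst h + jac2 g y w *v snd h)"
    by (rule ext)
  with G show "(?g has_derivative (\<lambda>h. jac1 g y w *v fst h + jac2 g y w *v snd h)) (at (y, w))"
    by simp
qed

lemma fwd_eq_pfwd: "fwd f w x i = pfwd f w x (\<lambda>_. 0) i"
  by (induction i) auto

text \<open>The update direction without the regulariser. Without perturbations it is the gradient
  of the network output, as \<open>grad_sample_loss\<close> shows.\<close>

definition noisy_grad ::
  "('y::finite \<Rightarrow> nat) \<Rightarrow> ('w::finite \<Rightarrow> nat) \<Rightarrow> nat \<Rightarrow> (nat \<Rightarrow> real^'y \<Rightarrow> real^'w \<Rightarrow> real^'y)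
    \<Rightarrow> real^'w \<Rightarrow> real^'y \<Rightarrow> (nat \<Rightarrow> real^'y) \<Rightarrow> (nat \<Rightarrow> real^'y) \<Rightarrow> real^'w" where
  "noisy_grad lay blk N f w x \<delta> \<epsilon> = (\<chi> k. pgrad lay N f w x \<delta> \<epsilon> (blk k) $ k)"

lemma norm_noisy_grad_diff_le:
  assumes "\<And>k. norm (pgrad lay N f w x \<delta> \<epsilon> (blk k) - pgrad lay N f w x \<delta>' \<epsilon>' (blk k)) \<le> B"
  shows "norm (noisy_grad lay (blk :: 'w::finite \<Rightarrow> nat) N f w x \<delta> \<epsilon> - noisy_grad lay blk N f w x \<delta>' \<epsilon>')
    \<le> real CARD('w) * B"
proof -
  let ?d = "noisy_grad lay blk N f w x \<delta> \<epsilon> - noisy_grad lay blk N f w x \<delta>' \<epsilon>'"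
  have "norm ?d \<le> (\<Sum>k\<in>UNIV. \<bar>?d $ k\<bar>)"
    by (rule norm_le_l1_cart)
  also have "\<dots> \<le> (\<Sum>k\<in>(UNIV :: 'w set). B)"
  proof (rule sum_mono)
    fix k
    have "\<bar>?d $ k\<bar> = \<bar>(pgrad lay N f w x \<delta> \<epsilon> (blk k) - pgrad lay N f w x \<delta>' \<epsilon>' (blk k)) $ k\<bar>"
      by (simp add: noisy_grad_def)
    also have "\<dots> \<le> B"
      by (rule order.trans[OF component_le_norm_cart assms])
    finally show "\<bar>?d $ k\<bar> \<le> B" .
  qed
  finally show ?thesis
    by simp
qed

lemma sgd_Suc:
  "sgd lay blk N f R w0 \<gamma> x \<delta> \<epsilon> (Suc t) =
     (let w = sgd lay blk N f R w0 \<gamma> x \<delta> \<epsilon> t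
      in w - \<gamma> *\<^sub>R (noisy_grad lay blk N f w (x t) (\<delta> t) (\<epsilon> t) + grad R w))"
  by (simp add: Let_def vec_eq_iff noisy_grad_def)

text \<open>The regularity constants are parameters, so that the error constants derived from them
  are uniform over all weights, samples and perturbations.\<close>

locale network =
  fixes lay :: "'y::finite \<Rightarrow> nat" and blk :: "'w::finite \<Rightarrow> nat" and N :: nat
    and f :: "nat \<Rightarrow> real^'y \<Rightarrow> real^'w \<Rightarrow> real^'y" and C L0 L1 :: real
  assumes blk_range: "blk k \<in> {1..N}"
    and layered: "layered_operators lay blk N f"
    and smooth: "i \<in> {1..N} \<Longrightarrow> twice_differentiable (f i)"
    and jac1_bound: "i \<in> {1..N} \<Longrightarrow> onorm (\<lambda>h. jac1 (f i) y w *v h) \<le> C"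
    and jac2_bound: "i \<in> {1..N} \<Longrightarrow> onorm (\<lambda>h. jac2 (f i) y w *v h) \<le> C"
    and f_lipschitz: "i \<in> {1..N} \<Longrightarrow> L0-lipschitz_on UNIV (\<lambda>y. f i y w)"
    and jac_lipschitz: "i \<in> {1..N} \<Longrightarrow> L1-lipschitz_on UNIV (\<lambda>y. jac (f i) y w)"
begin

abbreviation "y_val \<equiv> pfwd f"
abbreviation "v_val \<equiv> pbwd lay N f"
abbreviation "g_val \<equiv> noisy_grad lay blk N f"

lemma N_pos: "1 \<le> N"
  using blk_range[of undefined] by simp

lemma C_nonneg: "0 \<le> C"
proof -
  have "0 \<le> onorm (\<lambda>h. jac1 (f 1) 0 0 *v h)"
    by (rule onorm_pos_le) simp
  also have "\<dots> \<le> C"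
    using N_pos by (intro jac1_bound) simp
  finally show ?thesis .
qed

lemma L0_nonneg: "0 \<le> L0" and L1_nonneg: "0 \<le> L1"
  using lipschitz_on_nonneg[OF f_lipschitz[of 1]] lipschitz_on_nonneg[OF jac_lipschitz[of 1]] N_pos by auto

section \<open>Propagation of perturbations through the two passes\<close>

lemma v_val_step:
  "i < N \<Longrightarrow> v_val w x \<delta> \<epsilon> i =
     transpose (jac1 (f (Suc i)) (y_val w x \<delta> i) w) *v v_val w x \<delta> \<epsilon> (Suc i) + \<epsilon> (Suc i)"
  by (subst pbwd.simps) simp

lemma v_val_last: "v_val w x \<delta> \<epsilon> N = axis (out_coord lay N) 1"
  by (subst pbwd.simps) simp

text \<open>A layer enlarges the error received by at most its Lipschitz constant and adds its own
  perturbation, hence the factor \<open>L0 * K + 1\<close>. The constant is chosen before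
  \<open>w\<close>, \<open>x\<close> and \<open>\<delta>\<close>, because it must serve along the
  whole random trajectory.\<close>

lemma y_val_error:
  "i \<le> N \<Longrightarrow> \<exists>K\<ge>0. \<forall>w x \<delta>. norm (y_val w x \<delta> i - y_val w x (\<lambda>_. 0) i) \<le> K * (\<Sum>j\<in>{1..N}. norm (\<delta> j))"
proof (induction i)
  case 0
  then show ?case by (auto intro!: exI[of _ 0])
next
  case (Suc i)
  then obtain K where K: "0 \<le> K"
    "\<And>w x \<delta>. norm (y_val w x \<delta> i - y_val w x (\<lambda>_. 0) i) \<le> K * (\<Sum>j\<in>{1..N}. norm (\<delta> j))"
    by auto
  have "norm (y_val w x \<delta> (Suc i) - y_val w x (\<lambda>_. 0) (Suc i)) \<le> (L0 * K + 1) * (\<Sum>j\<in>{1..N}. norm (\<delta> j))"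
    for w x \<delta>
  proof -
    let ?S = "\<Sum>j\<in>{1..N}. norm (\<delta> j)"
    have "norm (y_val w x \<delta> (Suc i) - y_val w x (\<lambda>_. 0) (Suc i))
        \<le> norm (f (Suc i) (y_val w x \<delta> i) w - f (Suc i) (y_val w x (\<lambda>_. 0) i) w) + norm (\<delta> (Suc i))"
      using norm_triangle_ineq[of "f (Suc i) (y_val w x \<delta> i) w - f (Suc i) (y_val w x (\<lambda>_. 0) i) w" "\<delta> (Suc i)"]
      by (simp add: algebra_simps)
    also have "\<dots> \<le> L0 * norm (y_val w x \<delta> i - y_val w x (\<lambda>_. 0) i) + norm (\<delta> (Suc i))"
      using lipschitz_onD[OF f_lipschitz[of "Suc i" w], of "y_val w x \<delta> i" "y_val w x (\<lambda>_. 0) i"] Suc.prems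
      by (simp add: dist_norm)
    also have "\<dots> \<le> L0 * (K * ?S) + ?S"
      using Suc.prems by (intro add_mono mult_left_mono K L0_nonneg member_le_sum) auto
    finally show ?thesis
      by (simp add: algebra_simps)
  qed
  then show ?case
    using K L0_nonneg by (intro exI[of _ "L0 * K + 1"]) auto
qed

text \<open>Without backward perturbations the value is a product of transposed Jacobians applied to
  a unit vector, so the forward perturbations cannot make it large.\<close>

lemma v_val_bound:
  assumes "i \<le> N"
  shows "\<exists>K\<ge>0. \<forall>w x \<delta>. norm (v_val w x \<delta> (\<lambda>_. 0) i) \<le> K"
  using assms
proof (induction rule: inc_induct)
  case base
  show ?case by (auto simp: v_val_last intro!: exI[of _ 1])
next
  case (step i)
  then obtain K where K: "0 \<le> K" "\<And>w x \<delta>. norm (v_val w x \<delta> (\<lambda>_. 0) (Suc i)) \<le> K"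
    by auto
  have "norm (v_val w x \<delta> (\<lambda>_. 0) i) \<le> C * K" for w x \<delta>
  proof -
    have "norm (v_val w x \<delta> (\<lambda>_. 0) i) \<le> C * norm (v_val w x \<delta> (\<lambda>_. 0) (Suc i))"
      using norm_transpose_mult_le[OF jac1_bound[of "Suc i"]] step
      by (simp add: v_val_step del: transpose_matrix_vector)
    also have "\<dots> \<le> C * K"
      by (intro mult_left_mono K C_nonneg)
    finally show ?thesis .
  qed
  then show ?case
    using K C_nonneg by (intro exI[of _ "C * K"]) auto
qed

text \<open>A product rule in which the difference of Jacobians meets the reference vector
  \<open>v'\<close>. In the applications \<open>v'\<close> is bounded by \<open>v_val_bound\<close>,
  so the estimate stays linear in the perturbations.\<close>

lemma transpose_jac_mult_error:
  fixes J J' :: "real^'n^'y"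
  assumes "onorm (\<lambda>h. J *v h) \<le> C" "norm (J - J') \<le> a" "norm v' \<le> b" "norm (v - v') \<le> c" "0 \<le> b"
  shows "norm (transpose J *v v - transpose J' *v v') \<le> C * c + a * b"
proof -
  have "transpose J *v v - transpose J' *v v' = transpose J *v (v - v') + transpose (J - J') *v v'"
    by (simp add: transpose_diff matrix_vector_mult_diff_distrib matrix_vector_mult_diff_rdistrib)
  moreover have "norm (transpose J *v (v - v')) \<le> C * c"
    using norm_transpose_mult_le[OF assms(1), of "v - v'"] mult_left_mono[OF assms(4) C_nonneg] by linarith
  moreover have "norm (transpose (J - J') *v v') \<le> a * b"
  proof -
    have "norm (transpose (J - J') *v v') \<le> norm (J - J') * norm v'"
      by (rule norm_transpose_mult_le[OF onorm_matrix_le_norm])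
    also have "\<dots> \<le> a * b"
      using assms norm_ge_zero[of "J - J'"] by (intro mult_mono norm_ge_zero) linarith+
    finally show ?thesis .
  qed
  ultimately show ?thesis
    using norm_triangle_ineq[of "transpose J *v (v - v')" "transpose (J - J') *v v'"] by simp
qed

lemma v_val_forward_error:
  assumes "i \<le> N"
  shows "\<exists>K\<ge>0. \<forall>w x \<delta>. norm (v_val w x \<delta> (\<lambda>_. 0) i - v_val w x (\<lambda>_. 0) (\<lambda>_. 0) i)
    \<le> K * (\<Sum>j\<in>{1..N}. norm (\<delta> j))"
  using assms
proof (induction rule: inc_induct)
  case base
  show ?case by (auto simp: v_val_last intro!: exI[of _ 0])
next
  case (step i)
  then obtain K where K: "0 \<le> K" "\<And>w x \<delta>. norm (v_val w x \<delta> (\<lambda>_. 0) (Suc i) - v_val w x (\<lambda>_. 0) (\<lambda>_. 0) (Suc i))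
    \<le> K * (\<Sum>j\<in>{1..N}. norm (\<delta> j))"
    by auto
  obtain Y where Y: "0 \<le> Y"
    "\<And>w x \<delta>. norm (y_val w x \<delta> i - y_val w x (\<lambda>_. 0) i) \<le> Y * (\<Sum>j\<in>{1..N}. norm (\<delta> j))"
    using y_val_error[of i] step by auto
  obtain V where V: "0 \<le> V" "\<And>w x \<delta>. norm (v_val w x \<delta> (\<lambda>_. 0) (Suc i)) \<le> V"
    using v_val_bound[of "Suc i"] step by auto
  have "norm (v_val w x \<delta> (\<lambda>_. 0) i - v_val w x (\<lambda>_. 0) (\<lambda>_. 0) i)
    \<le> (C * K + L1 * Y * V) * (\<Sum>j\<in>{1..N}. norm (\<delta> j))" for w x \<delta>
  proof -
    let ?S = "\<Sum>j\<in>{1..N}. norm (\<delta> j)"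
    have "norm (jac1 (f (Suc i)) (y_val w x \<delta> i) w - jac1 (f (Suc i)) (y_val w x (\<lambda>_. 0) i) w)
        \<le> L1 * (Y * ?S)"
      using step by (intro order.trans[OF jac_component_diff(1)[OF jac_lipschitz]] mult_left_mono Y L1_nonneg) auto
    from transpose_jac_mult_error[OF jac1_bound this V(2) K(2) V(1)]
    show ?thesis
      using step by (simp add: v_val_step algebra_simps)
  qed
  then show ?case
    using K Y V C_nonneg L1_nonneg by (intro exI[of _ "C * K + L1 * Y * V"]) auto
qed

text \<open>Both passes use the same forward values and hence the same Jacobians; the difference
  obeys a linear recursion and no Lipschitz constant enters. Layer 0 is excluded because it would
  involve \<open>\<epsilon> 1\<close>, which lies outside the sum.\<close>

lemma v_val_backward_error:
  assumes "i \<le> N" "1 \<le> i"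
  shows "\<exists>K\<ge>0. \<forall>w x \<delta> \<epsilon>. norm (v_val w x \<delta> \<epsilon> i - v_val w x \<delta> (\<lambda>_. 0) i)
    \<le> K * (\<Sum>j\<in>{2..N}. norm (\<epsilon> j))"
  using assms
proof (induction rule: inc_induct)
  case base
  show ?case by (auto simp: v_val_last intro!: exI[of _ 0])
next
  case (step i)
  then obtain K where K: "0 \<le> K" "\<And>w x \<delta> \<epsilon>. norm (v_val w x \<delta> \<epsilon> (Suc i) - v_val w x \<delta> (\<lambda>_. 0) (Suc i))
    \<le> K * (\<Sum>j\<in>{2..N}. norm (\<epsilon> j))"
    by auto
  have "norm (v_val w x \<delta> \<epsilon> i - v_val w x \<delta> (\<lambda>_. 0) i) \<le> (C * K + 1) * (\<Sum>j\<in>{2..N}. norm (\<epsilon> j))" for w x \<delta> \<epsilon>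
  proof -
    let ?J = "jac1 (f (Suc i)) (y_val w x \<delta> i) w" and ?S = "\<Sum>j\<in>{2..N}. norm (\<epsilon> j)"
    let ?d = "v_val w x \<delta> \<epsilon> (Suc i) - v_val w x \<delta> (\<lambda>_. 0) (Suc i)"
    have "v_val w x \<delta> \<epsilon> i - v_val w x \<delta> (\<lambda>_. 0) i = transpose ?J *v ?d + \<epsilon> (Suc i)"
      using step by (simp add: v_val_step matrix_vector_mult_diff_distrib del: transpose_matrix_vector)
    moreover have "norm (transpose ?J *v ?d) \<le> C * (K * ?S)"
      using step by (intro order.trans[OF norm_transpose_mult_le[OF jac1_bound]] mult_left_mono K C_nonneg) auto
    moreover have "norm (\<epsilon> (Suc i)) \<le> ?S"
      using step by (intro member_le_sum) auto
    ultimately show ?thesis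
      using norm_triangle_ineq[of "transpose ?J *v ?d" "\<epsilon> (Suc i)"] by (simp add: distrib_right)
  qed
  then show ?case
    using K C_nonneg by (intro exI[of _ "C * K + 1"]) auto
qed

text \<open>The layers are finitely many, so the sum of their constants serves for all of them. The
  variable \<open>p\<close> stands for the tuple of all remaining arguments.\<close>

lemma uniform_block_bound:
  assumes "\<forall>i\<in>{1..N}. \<exists>K\<ge>0. \<forall>p. P i p \<le> K * (S p :: real)" and S: "\<And>p. 0 \<le> S p"
  shows "\<exists>K\<ge>0. \<forall>i\<in>{1..N}. \<forall>p. P i p \<le> K * S p"
proof -
  obtain K where K: "\<And>i. i \<in> {1..N} \<Longrightarrow> 0 \<le> K i" "\<And>i p. i \<in> {1..N} \<Longrightarrow> P i p \<le> K i * S p"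
    using assms(1) by metis
  have "P i p \<le> (\<Sum>j\<in>{1..N}. K j) * S p" if "i \<in> {1..N}" for i p
  proof -
    have "P i p \<le> K i * S p"
      using K that by blast
    also have "\<dots> \<le> (\<Sum>j\<in>{1..N}. K j) * S p"
      using K that by (intro mult_right_mono member_le_sum S) auto
    finally show ?thesis .
  qed
  moreover have "0 \<le> (\<Sum>j\<in>{1..N}. K j)"
    using K by (intro sum_nonneg) auto
  ultimately show ?thesis
    by blast
qed

lemma g_val_forward_error:
  "\<exists>K\<ge>0. \<forall>w x \<delta>. norm (g_val w x \<delta> (\<lambda>_. 0) - g_val w x (\<lambda>_. 0) (\<lambda>_. 0)) \<le> K * (\<Sum>j\<in>{1..N}. norm (\<delta> j))"
proof -
  let ?Q = "\<lambda>i. \<exists>K\<ge>0. \<forall>p. norm (pgrad lay N f (fst p) (fst (snd p)) (snd (snd p)) (\<lambda>_. 0) i -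
        pgrad lay N f (fst p) (fst (snd p)) (\<lambda>_. 0) (\<lambda>_. 0) i) \<le> K * (\<Sum>j\<in>{1..N}. norm (snd (snd p) j))"
  have "?Q i"
    if i: "i \<in> {1..N}" for i
  proof -
    have i': "i \<le> N" "i - 1 \<le> N"
      using i by auto
    obtain Y where Y: "0 \<le> Y"
      "\<And>w x \<delta>. norm (y_val w x \<delta> (i - 1) - y_val w x (\<lambda>_. 0) (i - 1)) \<le> Y * (\<Sum>j\<in>{1..N}. norm (\<delta> j))"
      using y_val_error[OF i'(2)] by auto
    obtain V where V: "0 \<le> V" "\<And>w x \<delta>. norm (v_val w x \<delta> (\<lambda>_. 0) i) \<le> V"
      using v_val_bound[OF i'(1)] by auto
    obtain K where K: "0 \<le> K"
      "\<And>w x \<delta>. norm (v_val w x \<delta> (\<lambda>_. 0) i - v_val w x (\<lambda>_. 0) (\<lambda>_. 0) i) \<le> K * (\<Sum>j\<in>{1..N}. norm (\<delta> j))"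
      using v_val_forward_error[OF i'(1)] by auto
    have "norm (pgrad lay N f w x \<delta> (\<lambda>_. 0) i - pgrad lay N f w x (\<lambda>_. 0) (\<lambda>_. 0) i)
        \<le> (C * K + L1 * Y * V) * (\<Sum>j\<in>{1..N}. norm (\<delta> j))" for w x \<delta>
    proof -
      let ?S = "\<Sum>j\<in>{1..N}. norm (\<delta> j)"
      have "norm (jac2 (f i) (y_val w x \<delta> (i - 1)) w - jac2 (f i) (y_val w x (\<lambda>_. 0) (i - 1)) w)
          \<le> L1 * (Y * ?S)"
        by (intro order.trans[OF jac_component_diff(2)[OF jac_lipschitz[OF i]]] mult_left_mono Y L1_nonneg)
      from transpose_jac_mult_error[OF jac2_bound[OF i] this V(2) K(2) V(1)]
      show ?thesis
        by (simp add: pgrad_def algebra_simps)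
    qed
    then show ?thesis
      using K Y V C_nonneg L1_nonneg by (intro exI[of _ "C * K + L1 * Y * V"]) auto
  qed
  then have "\<forall>i\<in>{1..N}. ?Q i"
    by blast
  from uniform_block_bound[OF this] obtain K where "0 \<le> K"
    "\<And>i w x \<delta>. i \<in> {1..N} \<Longrightarrow> norm (pgrad lay N f w x \<delta> (\<lambda>_. 0) i - pgrad lay N f w x (\<lambda>_. 0) (\<lambda>_. 0) i)
        \<le> K * (\<Sum>j\<in>{1..N}. norm (\<delta> j))"
    by (auto simp: sum_nonneg)
  with norm_noisy_grad_diff_le[OF this(2)[OF blk_range]] show ?thesis
    by (intro exI[of _ "real CARD('w) * K"]) (auto simp: mult.assoc)
qed

lemma pgrad_backward_error:
  "pgrad lay N f w x \<delta> \<epsilon> i - pgrad lay N f w x \<delta> (\<lambda>_. 0) i =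
     transpose (jac2 (f i) (y_val w x \<delta> (i - 1)) w) *v (v_val w x \<delta> \<epsilon> i - v_val w x \<delta> (\<lambda>_. 0) i)"
  by (simp add: pgrad_def matrix_vector_mult_diff_distrib)

lemma g_val_backward_error:
  "\<exists>K\<ge>0. \<forall>w x \<delta> \<epsilon>. norm (g_val w x \<delta> \<epsilon> - g_val w x \<delta> (\<lambda>_. 0)) \<le> K * (\<Sum>j\<in>{2..N}. norm (\<epsilon> j))"
proof -
  let ?Q = "\<lambda>i. \<exists>K\<ge>0. \<forall>p. norm (v_val (fst p) (fst (snd p)) (fst (snd (snd p))) (snd (snd (snd p))) i -
        v_val (fst p) (fst (snd p)) (fst (snd (snd p))) (\<lambda>_. 0) i) \<le> K * (\<Sum>j\<in>{2..N}. norm (snd (snd (snd p)) j))"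
  have "?Q i" if i: "i \<in> {1..N}" for i
    using v_val_backward_error[of i] i by auto
  then have "\<forall>i\<in>{1..N}. ?Q i"
    by blast
  from uniform_block_bound[OF this] obtain K where K: "0 \<le> K"
    "\<And>i w x \<delta> \<epsilon>. i \<in> {1..N} \<Longrightarrow> norm (v_val w x \<delta> \<epsilon> i - v_val w x \<delta> (\<lambda>_. 0) i) \<le> K * (\<Sum>j\<in>{2..N}. norm (\<epsilon> j))"
    by (auto simp: sum_nonneg)
  have "norm (pgrad lay N f w x \<delta> \<epsilon> i - pgrad lay N f w x \<delta> (\<lambda>_. 0) i) \<le> C * (K * (\<Sum>j\<in>{2..N}. norm (\<epsilon> j)))"
    if i: "i \<in> {1..N}" for i w x \<delta> \<epsilon>
    unfolding pgrad_backward_error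
    by (intro order.trans[OF norm_transpose_mult_le[OF jac2_bound[OF i]]] mult_left_mono K C_nonneg i)
  with norm_noisy_grad_diff_le[OF this[OF blk_range]] K C_nonneg show ?thesis
    by (intro exI[of _ "real CARD('w) * (C * K)"]) (auto simp: mult.assoc)
qed

section \<open>Backpropagation without perturbations is the gradient\<close>

lemma jac2_outside_block:
  assumes i: "i \<in> {1..N}" and k: "blk k \<noteq> i"
  shows "jac2 (f i) y w $ j $ k = 0"
proof -
  \<comment> \<open>The layer reads only weight block \<open>i\<close>, so it is constant along an
    axis outside that block and the corresponding column of the Jacobian vanishes.\<close>
  have eq: "f i y (w + t *\<^sub>R axis k 1) = f i y w" for t
  proof -
    have "part blk i (w + t *\<^sub>R axis k 1) = part blk i w"
      using k by (auto simp: part_def vec_eq_iff axis_def)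
    then show ?thesis
      using layered i unfolding layered_operators_def by metis
  qed
  have "((\<lambda>w'. (y, w')) has_derivative (\<lambda>h. (0, h))) (at w)"
    by (auto intro!: derivative_eq_intros)
  from has_derivative_compose[OF this twice_differentiable_has_derivative[OF smooth[OF i]]]
  have D: "((\<lambda>w'. f i y w') has_derivative (\<lambda>h. jac2 (f i) y w *v h)) (at w)"
    by simp
  have "((\<lambda>t::real. w + t *\<^sub>R axis k 1) has_derivative (\<lambda>t. t *\<^sub>R axis k 1)) (at 0)"
    by (auto intro!: derivative_eq_intros)
  from has_derivative_compose[OF this, of "\<lambda>w'. f i y w'" "\<lambda>h. jac2 (f i) y w *v h"] D
  have "((\<lambda>t::real. f i y w) has_derivative (\<lambda>t. jac2 (f i) y w *v (t *\<^sub>R axis k 1))) (at 0)"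
    by (simp add: eq)
  then have "(\<lambda>t::real. jac2 (f i) y w *v (t *\<^sub>R axis k 1)) = (\<lambda>t. 0)"
    using has_derivative_unique[OF _ has_derivative_const] by blast
  then have "jac2 (f i) y w *v (1 *\<^sub>R axis k 1) = 0"
    by meson
  then have "column k (jac2 (f i) y w) = 0"
    by (simp add: matrix_vector_mult_basis)
  then show ?thesis
    by (simp add: column_def vec_eq_iff)
qed

text \<open>
  The adjoint form of the chain rule: pairing the backward value \<open>v i\<close> with the derivative of the
  forward value \<open>y i\<close> and moving the Jacobians to the left splits off one summand per layer.
\<close>

lemma fwd_has_derivative:
  assumes "i \<le> N"
  shows "\<exists>F. ((\<lambda>w. fwd f w x i) has_derivative F) (at w) \<and>
    (\<forall>h. v_val w x (\<lambda>_. 0) (\<lambda>_. 0) i \<bullet> F h = (\<Sum>j\<in>{1..i}. pgrad lay N f w x (\<lambda>_. 0) (\<lambda>_. 0) j \<bullet> h))"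
  using assms
proof (induction i)
  case 0
  then show ?case by (auto intro!: exI[of _ "\<lambda>_. 0"])
next
  case (Suc i)
  then obtain F where F: "((\<lambda>w. fwd f w x i) has_derivative F) (at w)"
    "\<And>h. v_val w x (\<lambda>_. 0) (\<lambda>_. 0) i \<bullet> F h = (\<Sum>j\<in>{1..i}. pgrad lay N f w x (\<lambda>_. 0) (\<lambda>_. 0) j \<bullet> h)"
    by auto
  let ?y = "fwd f w x i"
  let ?J1 = "jac1 (f (Suc i)) ?y w" and ?J2 = "jac2 (f (Suc i)) ?y w"
  have "((\<lambda>w. (fwd f w x i, w)) has_derivative (\<lambda>h. (F h, h))) (at w)"
    using F(1) by (auto intro!: derivative_eq_intros)
  from has_derivative_compose[OF this twice_differentiable_has_derivative[OF smooth]] Suc.prems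
  have "((\<lambda>w. fwd f w x (Suc i)) has_derivative (\<lambda>h. ?J1 *v F h + ?J2 *v h)) (at w)"
    by simp
  moreover have "v_val w x (\<lambda>_. 0) (\<lambda>_. 0) (Suc i) \<bullet> (?J1 *v F h + ?J2 *v h)
      = (\<Sum>j\<in>{1..Suc i}. pgrad lay N f w x (\<lambda>_. 0) (\<lambda>_. 0) j \<bullet> h)" for h
  proof -
    let ?v = "v_val w x (\<lambda>_. 0) (\<lambda>_. 0) (Suc i)"
    have "?v \<bullet> (?J1 *v F h + ?J2 *v h) = (transpose ?J1 *v ?v) \<bullet> F h + (transpose ?J2 *v ?v) \<bullet> h"
      by (simp add: inner_add_right dot_lmul_matrix transpose_matrix_vector)
    also have "transpose ?J1 *v ?v = v_val w x (\<lambda>_. 0) (\<lambda>_. 0) i"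
      using Suc.prems by (simp add: v_val_step fwd_eq_pfwd)
    also have "transpose ?J2 *v ?v = pgrad lay N f w x (\<lambda>_. 0) (\<lambda>_. 0) (Suc i)"
      by (simp add: pgrad_def fwd_eq_pfwd)
    finally show ?thesis
      using F(2) by simp
  qed
  ultimately show ?case by blast
qed

text \<open>At layer \<open>N\<close> the backward value is the unit vector that reads off the
  output coordinate. In the sum over layers coordinate \<open>k\<close> survives only in the term of
  its own block, by \<open>jac2_outside_block\<close>, and this is how \<open>noisy_grad\<close> is
  assembled.\<close>

lemma grad_sample_loss:
  assumes R: "R differentiable (at w)"
  shows "grad (sample_loss lay N f R x) w = g_val w x (\<lambda>_. 0) (\<lambda>_. 0) + grad R w"
proof (rule grad_eqI)
  let ?p = "pgrad lay N f w x (\<lambda>_. 0) (\<lambda>_. 0)"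
  obtain F where F: "((\<lambda>w. fwd f w x N) has_derivative F) (at w)"
    "\<And>h. v_val w x (\<lambda>_. 0) (\<lambda>_. 0) N \<bullet> F h = (\<Sum>j\<in>{1..N}. ?p j \<bullet> h)"
    using fwd_has_derivative[of N x w] by auto
  have "?p j $ k = (if blk k = j then ?p (blk k) $ k else 0)" if "j \<in> {1..N}" for j k
    using that jac2_outside_block[OF that]
    by (auto simp: pgrad_def transpose_def matrix_vector_mult_def)
  then have "(\<Sum>j\<in>{1..N}. ?p j) $ k = (\<Sum>j\<in>{1..N}. if blk k = j then ?p (blk k) $ k else 0)" for k
    by (simp add: sum_component)
  then have sum: "(\<Sum>j\<in>{1..N}. ?p j) = g_val w x (\<lambda>_. 0) (\<lambda>_. 0)"
    using blk_range by (simp add: vec_eq_iff noisy_grad_def)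
  have "F h $ out_coord lay N = g_val w x (\<lambda>_. 0) (\<lambda>_. 0) \<bullet> h" for h
    using F(2)[of h] unfolding sum[symmetric]
    by (simp add: v_val_last inner_axis' inner_sum_left)
  moreover have "((\<lambda>w. fwd f w x N $ out_coord lay N + R w) has_derivative
      (\<lambda>h. F h $ out_coord lay N + grad R w \<bullet> h)) (at w)"
    by (intro has_derivative_add bounded_linear.has_derivative[OF bounded_linear_vec_nth]
        F(1) grad_has_derivative R)
  ultimately show "(sample_loss lay N f R x has_derivative
      (\<lambda>h. (g_val w x (\<lambda>_. 0) (\<lambda>_. 0) + grad R w) \<bullet> h)) (at w)"
    by (simp add: sample_loss_def[abs_def] inner_add_left)
qed

end

section \<open>Measurability and square integrability\<close>

lemma borel_measurable_vec_nth:
  fixes g :: "'a \<Rightarrow> 'b::topological_space^'n"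
  assumes "g \<in> borel_measurable M"
  shows "(\<lambda>\<omega>. g \<omega> $ k) \<in> borel_measurable M"
  by (rule borel_measurable_continuous_on[OF _ assms]) (intro continuous_intros)

lemma borel_measurable_matrix_vector_mult:
  fixes A :: "'a \<Rightarrow> real^'n^'m"
  assumes A: "A \<in> borel_measurable M" and v: "v \<in> borel_measurable M"
  shows "(\<lambda>\<omega>. A \<omega> *v v \<omega>) \<in> borel_measurable M"
proof (rule borel_measurable_vec)
  fix k
  have [measurable]: "(\<lambda>\<omega>. A \<omega> $ k $ j) \<in> borel_measurable M" "(\<lambda>\<omega>. v \<omega> $ j) \<in> borel_measurable M" for j
    by (intro borel_measurable_vec_nth A v)+
  show "(\<lambda>\<omega>. (A \<omega> *v v \<omega>) $ k) \<in> borel_measurable M"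
    by (simp add: matrix_vector_mult_def)
qed

lemma borel_measurable_transpose_mult:
  fixes A :: "'a \<Rightarrow> real^'n^'m"
  assumes A: "A \<in> borel_measurable M" and v: "v \<in> borel_measurable M"
  shows "(\<lambda>\<omega>. transpose (A \<omega>) *v v \<omega>) \<in> borel_measurable M"
proof (rule borel_measurable_vec)
  fix k
  have [measurable]: "(\<lambda>\<omega>. A \<omega> $ j $ k) \<in> borel_measurable M" "(\<lambda>\<omega>. v \<omega> $ j) \<in> borel_measurable M" for j
    by (intro borel_measurable_vec_nth A v)+
  show "(\<lambda>\<omega>. (transpose (A \<omega>) *v v \<omega>) $ k) \<in> borel_measurable M"
    by (simp add: matrix_vector_mult_def transpose_def del: transpose_matrix_vector)
qed

lemma integrable_inner:
  fixes g h :: "'a \<Rightarrow> real^'n"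
  assumes [measurable]: "g \<in> borel_measurable M" "h \<in> borel_measurable M"
    and g: "integrable M (\<lambda>\<omega>. (norm (g \<omega>))\<^sup>2)" and h: "integrable M (\<lambda>\<omega>. (norm (h \<omega>))\<^sup>2)"
  shows "integrable M (\<lambda>\<omega>. g \<omega> \<bullet> h \<omega>)"
proof (rule Bochner_Integration.integrable_bound[OF Bochner_Integration.integrable_add[OF g h]])
  have "\<bar>g \<omega> \<bullet> h \<omega>\<bar> \<le> (norm (g \<omega>))\<^sup>2 + (norm (h \<omega>))\<^sup>2" for \<omega>
  proof -
    have "\<bar>g \<omega> \<bullet> h \<omega>\<bar> \<le> norm (g \<omega>) * norm (h \<omega>)"
      by (rule Cauchy_Schwarz_ineq2)
    also have "\<dots> \<le> (norm (g \<omega>))\<^sup>2 + (norm (h \<omega>))\<^sup>2"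
      using sum_squares_bound[of "norm (g \<omega>)" "norm (h \<omega>)"]
        mult_nonneg_nonneg[OF norm_ge_zero norm_ge_zero, of "g \<omega>" "h \<omega>"] by linarith
    finally show ?thesis .
  qed
  then show "AE \<omega> in M. norm (g \<omega> \<bullet> h \<omega>) \<le> norm ((norm (g \<omega>))\<^sup>2 + (norm (h \<omega>))\<^sup>2)"
    by (intro always_eventually allI) (simp add: order.trans[OF _ abs_ge_self])
qed measurable

lemma (in finite_measure) integrable_AE_bounded:
  fixes g :: "'a \<Rightarrow> real^'n"
  assumes [measurable]: "g \<in> borel_measurable M" and "AE \<omega> in M. norm (g \<omega>) \<le> B"
  shows "integrable M (\<lambda>\<omega>. (norm (g \<omega>))\<^sup>2)"
proof (rule integrable_const_bound)
  show "AE \<omega> in M. norm ((norm (g \<omega>))\<^sup>2) \<le> B\<^sup>2"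
    using assms(2) by eventually_elim (simp add: power_mono)
qed measurable

lemma norm_sum4_power2_le:
  fixes a b c d :: "'a::real_inner"
  shows "(norm (a + b + c + d))\<^sup>2 \<le> 4 * ((norm a)\<^sup>2 + (norm b)\<^sup>2 + (norm c)\<^sup>2 + (norm d)\<^sup>2)"
proof -
  have "(norm (a + b + c + d))\<^sup>2 \<le> (norm a + norm b + norm c + norm d)\<^sup>2"
    using norm_triangle_ineq[of "a + b + c" d] norm_triangle_ineq[of "a + b" c] norm_triangle_ineq[of a b]
    by (intro power_mono norm_ge_zero) linarith
  also have "\<dots> \<le> 4 * ((norm a)\<^sup>2 + (norm b)\<^sup>2 + (norm c)\<^sup>2 + (norm d)\<^sup>2)"
    using sum_squares_bound[of "norm a" "norm b"] sum_squares_bound[of "norm a" "norm c"]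
      sum_squares_bound[of "norm a" "norm d"] sum_squares_bound[of "norm b" "norm c"]
      sum_squares_bound[of "norm b" "norm d"] sum_squares_bound[of "norm c" "norm d"]
    by (simp add: power2_eq_square algebra_simps)
  finally show ?thesis .
qed

section \<open>Generated sigma-algebras\<close>

lemma space_extend_sigma [simp]: "space (extend_sigma F I Z) = space F"
  unfolding extend_sigma_def by (rule space_measure_of) (use sets.space_closed in auto)

lemma sets_extend_sigma:
  "sets (extend_sigma F I Z) =
    sigma_sets (space F) (sets F \<union> {Z k -` A \<inter> space F | k A. k \<in> I \<and> A \<in> sets borel})"
  unfolding extend_sigma_def by (rule sets_measure_of) (use sets.space_closed in auto)

lemma subalgebra_extend_sigma_base: "subalgebra (extend_sigma F I Z) F"
  unfolding subalgebra_def by (auto simp: sets_extend_sigma intro: sigma_sets.Basic)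

lemma measurable_extend_sigma: "k \<in> I \<Longrightarrow> Z k \<in> borel_measurable (extend_sigma F I Z)"
  by (rule measurableI) (auto simp: sets_extend_sigma intro!: sigma_sets.Basic)

lemma subalgebra_extend_sigma:
  assumes F: "subalgebra M F" and Z: "\<And>k. k \<in> I \<Longrightarrow> Z k \<in> borel_measurable M"
  shows "subalgebra M (extend_sigma F I Z)"
proof -
  have sp: "space F = space M"
    using F by (simp add: subalgebra_def)
  have "sigma_sets (space M) (sets F \<union> {Z k -` A \<inter> space M | k A. k \<in> I \<and> A \<in> sets borel}) \<subseteq> sets M"
    using F Z by (intro sets.sigma_sets_subset) (auto simp: subalgebra_def intro: measurable_sets)
  then show ?thesis
    by (simp add: subalgebra_def sets_extend_sigma sp)
qed

lemma subalgebra_trans: "subalgebra M H \<Longrightarrow> subalgebra H G \<Longrightarrow> subalgebra M G"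
  by (auto simp: subalgebra_def)

lemma space_past_sigma [simp]: "space (past_sigma M N x \<delta> \<epsilon> t) = space M"
  unfolding past_sigma_def by (rule space_measure_of) auto

lemma sets_past_sigma:
  "sets (past_sigma M N x \<delta> \<epsilon> t) = sigma_sets (space M)
     ({x s -` A \<inter> space M | s A. s < t \<and> A \<in> sets borel} \<union>
      {\<delta> s i -` A \<inter> space M | s i A. s < t \<and> i \<in> {1..N} \<and> A \<in> sets borel} \<union>
      {\<epsilon> s i -` A \<inter> space M | s i A. s < t \<and> i \<in> {2..N} \<and> A \<in> sets borel})"
  unfolding past_sigma_def by (rule sets_measure_of) auto

lemma measurable_past_sigma:
  fixes x :: "nat \<Rightarrow> 'a \<Rightarrow> real^'y::finite"
  assumes "s < t"
  shows "x s \<in> borel_measurable (past_sigma M N x \<delta> \<epsilon> t)"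
    and "i \<in> {1..N} \<Longrightarrow> \<delta> s i \<in> borel_measurable (past_sigma M N x \<delta> \<epsilon> t)"
    and "i \<in> {2..N} \<Longrightarrow> \<epsilon> s i \<in> borel_measurable (past_sigma M N x \<delta> \<epsilon> t)"
proof -
  show "x s \<in> borel_measurable (past_sigma M N x \<delta> \<epsilon> t)"
  proof (rule measurableI)
    fix A :: "(real^'y) set"
    assume "A \<in> sets borel"
    then show "x s -` A \<inter> space (past_sigma M N x \<delta> \<epsilon> t) \<in> sets (past_sigma M N x \<delta> \<epsilon> t)"
      unfolding sets_past_sigma space_past_sigma using assms
      by (intro sigma_sets.Basic) (rule UnI1, rule UnI1, auto)
  qed simp
  show "\<delta> s i \<in> borel_measurable (past_sigma M N x \<delta> \<epsilon> t)" if "i \<in> {1..N}"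
  proof (rule measurableI)
    fix A :: "(real^'y) set"
    assume "A \<in> sets borel"
    then show "\<delta> s i -` A \<inter> space (past_sigma M N x \<delta> \<epsilon> t) \<in> sets (past_sigma M N x \<delta> \<epsilon> t)"
      unfolding sets_past_sigma space_past_sigma using assms that
      by (intro sigma_sets.Basic) (rule UnI1, rule UnI2, auto)
  qed simp
  show "\<epsilon> s i \<in> borel_measurable (past_sigma M N x \<delta> \<epsilon> t)" if "i \<in> {2..N}"
  proof (rule measurableI)
    fix A :: "(real^'y) set"
    assume "A \<in> sets borel"
    then show "\<epsilon> s i -` A \<inter> space (past_sigma M N x \<delta> \<epsilon> t) \<in> sets (past_sigma M N x \<delta> \<epsilon> t)"
      unfolding sets_past_sigma space_past_sigma using assms that
      by (intro sigma_sets.Basic) (rule UnI2, auto)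
  qed simp
qed

lemma subalgebra_past_sigma:
  assumes "\<And>s. s < t \<Longrightarrow> x s \<in> borel_measurable M"
    and "\<And>s i. s < t \<Longrightarrow> i \<in> {1..N} \<Longrightarrow> \<delta> s i \<in> borel_measurable M"
    and "\<And>s i. s < t \<Longrightarrow> i \<in> {2..N} \<Longrightarrow> \<epsilon> s i \<in> borel_measurable M"
  shows "subalgebra M (past_sigma M N x \<delta> \<epsilon> t)"
proof -
  have "sets (past_sigma M N x \<delta> \<epsilon> t) \<subseteq> sets M"
    unfolding sets_past_sigma
    by (intro sets.sigma_sets_subset) (use assms in \<open>auto intro: measurable_sets\<close>)
  then show ?thesis
    by (simp add: subalgebra_def)
qed

context network
begin

text \<open>Here and in the next lemmas \<open>F\<close> stays arbitrary: measurability is needed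
  with respect to the whole space, the past, the information after the forward pass, and the product
  space of weights and sample.\<close>

lemma measurable_f:
  assumes "i \<in> {1..N}" "y \<in> borel_measurable F" "w \<in> borel_measurable F"
  shows "(\<lambda>\<omega>. f i (y \<omega>) (w \<omega>)) \<in> borel_measurable F"
  by (rule borel_measurable_continuous_Pair[OF assms(2,3) twice_differentiable_continuous[OF smooth[OF assms(1)]]])

lemma measurable_jac1:
  assumes "i \<in> {1..N}" "y \<in> borel_measurable F" "w \<in> borel_measurable F"
  shows "(\<lambda>\<omega>. jac1 (f i) (y \<omega>) (w \<omega>)) \<in> borel_measurable F"
  by (rule borel_measurable_continuous_Pair[OF assms(2,3) twice_differentiable_continuous_jac1[OF smooth[OF assms(1)]]])

lemma measurable_jac2:
  assumes "i \<in> {1..N}" "y \<in> borel_measurable F" "w \<in> borel_measurable F"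
  shows "(\<lambda>\<omega>. jac2 (f i) (y \<omega>) (w \<omega>)) \<in> borel_measurable F"
  by (rule borel_measurable_continuous_Pair[OF assms(2,3) twice_differentiable_continuous_jac2[OF smooth[OF assms(1)]]])

lemma measurable_y_val:
  assumes "w \<in> borel_measurable F" "x \<in> borel_measurable F"
    and "\<And>j. j \<in> {1..N} \<Longrightarrow> (\<lambda>\<omega>. \<delta> \<omega> j) \<in> borel_measurable F"
  shows "i \<le> N \<Longrightarrow> (\<lambda>\<omega>. y_val (w \<omega>) (x \<omega>) (\<delta> \<omega>) i) \<in> borel_measurable F"
proof (induction i)
  case 0
  then show ?case using assms by simp
next
  case (Suc i)
  then show ?case
    using assms by (auto intro!: borel_measurable_add measurable_f)
qed

lemma measurable_v_val:
  assumes "w \<in> borel_measurable F" "x \<in> borel_measurable F"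
    and "\<And>j. j \<in> {1..N} \<Longrightarrow> (\<lambda>\<omega>. \<delta> \<omega> j) \<in> borel_measurable F"
    and "\<And>j. j \<in> {2..N} \<Longrightarrow> (\<lambda>\<omega>. \<epsilon> \<omega> j) \<in> borel_measurable F"
    and "i \<le> N" "1 \<le> i"
  shows "(\<lambda>\<omega>. v_val (w \<omega>) (x \<omega>) (\<delta> \<omega>) (\<epsilon> \<omega>) i) \<in> borel_measurable F"
  using assms(5,6)
proof (induction rule: inc_induct)
  case base
  show ?case by (simp add: v_val_last)
next
  case (step i)
  then show ?case
    using assms by (auto simp: v_val_step simp del: transpose_matrix_vector
      intro!: borel_measurable_add borel_measurable_transpose_mult measurable_jac1 measurable_y_val)
qed

lemma measurable_g_val:
  assumes "w \<in> borel_measurable F" "x \<in> borel_measurable F"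
    and "\<And>j. j \<in> {1..N} \<Longrightarrow> (\<lambda>\<omega>. \<delta> \<omega> j) \<in> borel_measurable F"
    and "\<And>j. j \<in> {2..N} \<Longrightarrow> (\<lambda>\<omega>. \<epsilon> \<omega> j) \<in> borel_measurable F"
  shows "(\<lambda>\<omega>. g_val (w \<omega>) (x \<omega>) (\<delta> \<omega>) (\<epsilon> \<omega>)) \<in> borel_measurable F"
proof (rule borel_measurable_vec)
  fix k
  have "blk k \<le> N" "1 \<le> blk k" "blk k - 1 \<le> N"
    using blk_range[of k] by auto
  then show "(\<lambda>\<omega>. g_val (w \<omega>) (x \<omega>) (\<delta> \<omega>) (\<epsilon> \<omega>) $ k) \<in> borel_measurable F"
    using assms blk_range[of k] unfolding noisy_grad_def pgrad_def
    by (auto simp del: transpose_matrix_vector intro!: borel_measurable_vec_nth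
      borel_measurable_transpose_mult measurable_jac2 measurable_y_val measurable_v_val)
qed

end

section \<open>The stochastic process\<close>

text \<open>One run with a fixed horizon. All constants that may enter the final bound
  (\<open>L\<close>, \<open>\<sigma>\<close>, \<open>\<mu>\<close>, \<open>Kf\<close>,
  \<open>Kb\<close>, \<open>c\<close>) are parameters, so a bound in terms of them is visibly
  independent of \<open>T\<close>. The step size is unrestricted at first; its smallness is assumed
  only where the descent argument begins.\<close>

locale sgd_process = network lay blk N f C L0 L1 + prob_space M
  for lay :: "'y::finite \<Rightarrow> nat" and blk :: "'w::finite \<Rightarrow> nat" and N f C L0 L1
    and M :: "'a measure" +
  fixes R :: "real^'w \<Rightarrow> real" and D :: "(real^'y) measure" and l :: "real^'w \<Rightarrow> real"
    and w0 :: "real^'w" and x :: "nat \<Rightarrow> 'a \<Rightarrow> real^'y" and \<delta> \<epsilon> :: "nat \<Rightarrow> nat \<Rightarrow> 'a \<Rightarrow> real^'y"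
    and W :: "nat \<Rightarrow> 'a \<Rightarrow> real^'w"
    and T :: nat and \<gamma> L \<sigma> \<mu> lmin Kf Kb c :: real
  defines "W \<equiv> \<lambda>t \<omega>. sgd lay blk N f R w0 \<gamma> (\<lambda>s. x s \<omega>) (\<lambda>s i. \<delta> s i \<omega>) (\<lambda>s i. \<epsilon> s i \<omega>) t"
  assumes R_diff: "R differentiable (at w)"
    and D_prob: "prob_space D" and D_sets: "sets D = sets borel"
    and l_diff: "l differentiable (at w)" and l_lipschitz: "L-lipschitz_on UNIV (grad l)"
    and noise_mean: "integrable D (\<lambda>x. grad (sample_loss lay N f R x) w)"
      "(\<integral>x. grad (sample_loss lay N f R x) w \<partial>D) = grad l w"
    and noise_var: "integrable D (\<lambda>x. (norm (grad (sample_loss lay N f R x) w - grad l w))\<^sup>2)"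
      "(\<integral>x. (norm (grad (sample_loss lay N f R x) w - grad l w))\<^sup>2 \<partial>D) \<le> \<sigma>\<^sup>2"
    and pl: "2 * \<mu> * (l w - lmin) \<le> (norm (grad l w))\<^sup>2" and lmin: "lmin \<le> l w"
    and forward_error: "norm (g_val w z d (\<lambda>_. 0) - g_val w z (\<lambda>_. 0) (\<lambda>_. 0)) \<le> Kf * (\<Sum>j\<in>{1..N}. norm (d j))"
    and backward_error: "norm (g_val w z d e - g_val w z d (\<lambda>_. 0)) \<le> Kb * (\<Sum>j\<in>{2..N}. norm (e j))"
    and Kf: "0 \<le> Kf" and Kb: "0 \<le> Kb"
    and randomness: "sgd_randomness M D lay N T x \<delta> \<epsilon>"
    and zero_mean: "zero_mean_perturbations M lay N f T W x \<delta> \<epsilon>"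
    and bounded: "perturbation_bound M N T \<delta> \<epsilon> c"
    and few: "AE \<omega> in M. real (occurrences {1..N} T \<delta> \<omega>) \<le> c"
begin

abbreviation "past \<equiv> past_sigma M N x \<delta> \<epsilon>"
abbreviation "d t \<omega> \<equiv> (\<lambda>i. \<delta> t i \<omega>)"
abbreviation "e t \<omega> \<equiv> (\<lambda>i. \<epsilon> t i \<omega>)"
abbreviation "G t \<omega> \<equiv> grad l (W t \<omega>)"
abbreviation "noise z w \<equiv> g_val w z (\<lambda>_. 0) (\<lambda>_. 0) + grad R w - grad l w"
abbreviation "fe t \<omega> \<equiv> g_val (W t \<omega>) (x t \<omega>) (d t \<omega>) (\<lambda>_. 0) - g_val (W t \<omega>) (x t \<omega>) (\<lambda>_. 0) (\<lambda>_. 0)"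
abbreviation "be t \<omega> \<equiv> g_val (W t \<omega>) (x t \<omega>) (d t \<omega>) (e t \<omega>) - g_val (W t \<omega>) (x t \<omega>) (d t \<omega>) (\<lambda>_. 0)"

lemma W_0: "W 0 \<omega> = w0"
  by (simp add: W_def)

text \<open>The four summands telescope: adding \<open>noise\<close> to the gradient of
  \<open>l\<close> gives the unperturbed sample gradient, \<open>fe\<close> switches on the forward
  perturbations and \<open>be\<close> the backward ones.\<close>

lemma W_Suc: "W (Suc t) \<omega> = W t \<omega> - \<gamma> *\<^sub>R (G t \<omega> + noise (x t \<omega>) (W t \<omega>) + fe t \<omega> + be t \<omega>)"
  unfolding W_def sgd_Suc Let_def by simp

lemma x_measurable: "t < T \<Longrightarrow> x t \<in> borel_measurable M"
  and x_distr: "t < T \<Longrightarrow> distr M borel (x t) = D"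
  and x_indep: "t < T \<Longrightarrow> indep_set (sets (past t)) {x t -` A \<inter> space M | A. A \<in> sets borel}"
  and \<delta>_measurable: "t < T \<Longrightarrow> i \<in> {1..N} \<Longrightarrow> \<delta> t i \<in> borel_measurable M"
  and \<epsilon>_measurable: "t < T \<Longrightarrow> i \<in> {2..N} \<Longrightarrow> \<epsilon> t i \<in> borel_measurable M"
  using randomness unfolding sgd_randomness_def by blast+

lemma grad_l_measurable: "grad l \<in> borel_measurable borel"
  using l_diff by (rule borel_measurable_grad)

text \<open>\<open>R\<close> is only differentiable, so its gradient may be discontinuous and
  measurability has to come from difference quotients.\<close>

lemma grad_R_measurable: "grad R \<in> borel_measurable borel"
  using R_diff by (rule borel_measurable_grad)

lemma l_measurable: "l \<in> borel_measurable borel"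
  using l_diff by (intro borel_measurable_continuous_onI)
    (simp add: continuous_at_imp_continuous_on differentiable_imp_continuous_within)

lemma past_subalgebra: "t \<le> T \<Longrightarrow> subalgebra M (past t)"
  by (intro subalgebra_past_sigma x_measurable \<delta>_measurable \<epsilon>_measurable) auto

lemma W_measurable_past: "W t \<in> borel_measurable (past t)"
proof -
  \<comment> \<open>The sigma-algebra is kept fixed at time \<open>t\<close> while the induction
    runs over the earlier times \<open>s\<close>.\<close>
  have "W s \<in> borel_measurable (past t)" if "s \<le> t" for s
    using that
  proof (induction s)
    case 0
    then show ?case by (simp add: W_0[abs_def])
  next
    case (Suc s)
    then have Wm: "W s \<in> borel_measurable (past t)" and s: "s < t"
      by auto
    have "(\<lambda>\<omega>. g_val (W s \<omega>) (x s \<omega>) (d s \<omega>) (e s \<omega>)) \<in> borel_measurable (past t)"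
      by (rule measurable_g_val) (auto intro!: Wm measurable_past_sigma s)
    moreover have "(\<lambda>\<omega>. grad R (W s \<omega>)) \<in> borel_measurable (past t)"
      by (rule measurable_compose[OF Wm grad_R_measurable])
    moreover have "W (Suc s) = (\<lambda>\<omega>. W s \<omega> - \<gamma> *\<^sub>R (g_val (W s \<omega>) (x s \<omega>) (d s \<omega>) (e s \<omega>) + grad R (W s \<omega>)))"
      by (simp add: W_Suc fun_eq_iff)
    ultimately show ?case
      using Wm by simp
  qed
  then show ?thesis by simp
qed

lemma W_measurable: "t \<le> T \<Longrightarrow> W t \<in> borel_measurable M"
  by (rule measurable_from_subalg[OF past_subalgebra W_measurable_past])

lemma G_measurable: "t \<le> T \<Longrightarrow> G t \<in> borel_measurable M"
  by (rule measurable_compose[OF W_measurable grad_l_measurable])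

lemma g_measurable:
  assumes "t < T"
  shows "(\<lambda>\<omega>. g_val (W t \<omega>) (x t \<omega>) (\<lambda>_. 0) (\<lambda>_. 0)) \<in> borel_measurable M"
    "(\<lambda>\<omega>. g_val (W t \<omega>) (x t \<omega>) (d t \<omega>) (\<lambda>_. 0)) \<in> borel_measurable M"
    "(\<lambda>\<omega>. g_val (W t \<omega>) (x t \<omega>) (d t \<omega>) (e t \<omega>)) \<in> borel_measurable M"
  using assms by (auto intro!: measurable_g_val W_measurable x_measurable \<delta>_measurable \<epsilon>_measurable)

lemma fe_measurable: "t < T \<Longrightarrow> fe t \<in> borel_measurable M"
  and be_measurable: "t < T \<Longrightarrow> be t \<in> borel_measurable M"
  using g_measurable by (auto intro!: borel_measurable_diff)

section \<open>Sampling noise\<close>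

lemma noise_measurable_pair: "(\<lambda>p. noise (snd p) (fst p)) \<in> borel_measurable (borel \<Otimes>\<^sub>M borel)"
proof -
  have "(\<lambda>p. g_val (fst p) (snd p) (\<lambda>_. 0) (\<lambda>_. 0)) \<in> borel_measurable (borel \<Otimes>\<^sub>M borel)"
    by (rule measurable_g_val) auto
  moreover have "(\<lambda>p. grad R (fst p)) \<in> borel_measurable (borel \<Otimes>\<^sub>M borel)"
    by (rule measurable_compose[OF measurable_fst grad_R_measurable])
  moreover have "(\<lambda>p. grad l (fst p)) \<in> borel_measurable (borel \<Otimes>\<^sub>M borel)"
    by (rule measurable_compose[OF measurable_fst grad_l_measurable])
  ultimately show ?thesis
    by (intro borel_measurable_diff borel_measurable_add)
qed

lemma noise_measurable: "t < T \<Longrightarrow> (\<lambda>\<omega>. noise (x t \<omega>) (W t \<omega>)) \<in> borel_measurable M"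
  using g_measurable(1) W_measurable[of t]
  by (intro borel_measurable_diff borel_measurable_add measurable_compose[OF _ grad_R_measurable]
      measurable_compose[OF _ grad_l_measurable]) auto

lemma noise_eq: "noise z w = grad (sample_loss lay N f R z) w - grad l w"
  by (simp add: grad_sample_loss[OF R_diff])

text \<open>The weights are determined by the past and the sample is independent of it. With a
  product law the weights can be frozen while the sample is integrated, which is the situation of
  the stochasticity assumption.\<close>

lemma joint_distr:
  assumes t: "t < T"
  shows "distr M (borel \<Otimes>\<^sub>M borel) (\<lambda>\<omega>. (W t \<omega>, x t \<omega>)) = distr M borel (W t) \<Otimes>\<^sub>M D"
proof -
  have Wm: "W t \<in> borel_measurable M" and xm: "x t \<in> borel_measurable M"
    using t W_measurable x_measurable by auto
  have W_past: "W t -` A \<inter> space M \<in> sets (past t)" if "A \<in> sets borel" for A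
    using measurable_sets[OF W_measurable_past that] by simp
  let ?J = "distr M (borel \<Otimes>\<^sub>M borel) (\<lambda>\<omega>. (W t \<omega>, x t \<omega>))"
  have Jm: "(\<lambda>\<omega>. (W t \<omega>, x t \<omega>)) \<in> M \<rightarrow>\<^sub>M borel \<Otimes>\<^sub>M borel"
    using Wm xm by (rule measurable_Pair)
  have sets_eq: "sets (distr M borel (W t) \<Otimes>\<^sub>M D) = sets ?J"
    using sets_pair_measure_cong[of "distr M borel (W t)" borel D borel] D_sets by simp
  show ?thesis
  proof (rule pair_measure_eqI[symmetric])
    show "sigma_finite_measure (distr M borel (W t))" "sigma_finite_measure D"
      using prob_space_imp_sigma_finite[OF prob_space_distr[OF Wm]] prob_space_imp_sigma_finite[OF D_prob] .
    show "sets (distr M borel (W t) \<Otimes>\<^sub>M D) = sets ?J"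
      by (rule sets_eq)
    fix A B
    assume "A \<in> sets (distr M borel (W t))" "B \<in> sets D"
    then have A: "A \<in> sets borel" and B: "B \<in> sets borel"
      by (auto simp: D_sets)
    have "emeasure ?J (A \<times> B) = prob ((W t -` A \<inter> space M) \<inter> (x t -` B \<inter> space M))"
      using A B by (subst emeasure_distr[OF Jm]) (auto simp: emeasure_eq_measure intro!: arg_cong[where f=prob])
    also have "\<dots> = prob (W t -` A \<inter> space M) * prob (x t -` B \<inter> space M)"
      using W_past[OF A] B by (intro arg_cong[where f=ennreal] indep_setD[OF x_indep[OF t]]) auto
    also have "\<dots> = emeasure (distr M borel (W t)) A * emeasure (distr M borel (x t)) B"
      using A B by (simp add: emeasure_distr[OF Wm] emeasure_distr[OF xm] emeasure_eq_measure ennreal_mult)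
    finally show "emeasure (distr M borel (W t)) A * emeasure D B = emeasure ?J (A \<times> B)"
      by (simp add: x_distr[OF t])
  qed
qed

text \<open>Tonelli's theorem for nonnegative integrals asks for no integrability; the inner
  integral is the variance at frozen weights. The finite bound obtained then yields
  integrability.\<close>

lemma noise_square:
  assumes t: "t < T"
  shows "integrable M (\<lambda>\<omega>. (norm (noise (x t \<omega>) (W t \<omega>)))\<^sup>2)"
    and "(\<integral>\<omega>. (norm (noise (x t \<omega>) (W t \<omega>)))\<^sup>2 \<partial>M) \<le> \<sigma>\<^sup>2"
proof -
  let ?P = "distr M borel (W t)" and ?h = "\<lambda>\<omega>. (norm (noise (x t \<omega>) (W t \<omega>)))\<^sup>2"
  have Wm: "W t \<in> borel_measurable M" and xm: "x t \<in> borel_measurable M"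
    using t W_measurable x_measurable by auto
  interpret P: prob_space ?P
    by (rule prob_space_distr[OF Wm])
  interpret D: prob_space D
    by (rule D_prob)
  let ?q = "\<lambda>p. ennreal ((norm (noise (snd p) (fst p)))\<^sup>2)"
  have q: "?q \<in> borel_measurable (borel \<Otimes>\<^sub>M borel)"
    using noise_measurable_pair by measurable
  have sets_eq: "sets (?P \<Otimes>\<^sub>M D) = sets (borel \<Otimes>\<^sub>M borel)"
    by (intro sets_pair_measure_cong) (auto simp: D_sets)
  have "(\<integral>\<^sup>+\<omega>. ennreal (?h \<omega>) \<partial>M) = (\<integral>\<^sup>+p. ?q p \<partial>distr M (borel \<Otimes>\<^sub>M borel) (\<lambda>\<omega>. (W t \<omega>, x t \<omega>)))"
    using Wm xm q by (subst nn_integral_distr) (auto intro!: measurable_Pair)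
  also have "\<dots> = (\<integral>\<^sup>+w. \<integral>\<^sup>+z. ?q (w, z) \<partial>D \<partial>?P)"
    unfolding joint_distr[OF t]
    by (rule D.nn_integral_fst[symmetric]) (use q measurable_cong_sets[OF sets_eq refl] in auto)
  also have "\<dots> \<le> (\<integral>\<^sup>+w. ennreal (\<sigma>\<^sup>2) \<partial>?P)"
  proof (rule nn_integral_mono)
    fix w
    have "(\<integral>\<^sup>+z. ?q (w, z) \<partial>D) = ennreal (\<integral>z. (norm (grad (sample_loss lay N f R z) w - grad l w))\<^sup>2 \<partial>D)"
      unfolding noise_eq fst_conv snd_conv by (rule nn_integral_eq_integral[OF noise_var(1)]) simp
    also have "\<dots> \<le> ennreal (\<sigma>\<^sup>2)"
      by (rule ennreal_leI[OF noise_var(2)])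
    finally show "(\<integral>\<^sup>+z. ?q (w, z) \<partial>D) \<le> ennreal (\<sigma>\<^sup>2)" .
  qed
  also have "\<dots> = ennreal (\<sigma>\<^sup>2)"
    using P.emeasure_space_1 by simp
  finally have le: "(\<integral>\<^sup>+\<omega>. ennreal (?h \<omega>) \<partial>M) \<le> ennreal (\<sigma>\<^sup>2)" .
  show int: "integrable M ?h"
    using noise_measurable[OF t] le
    by (intro integrableI_bounded) (auto simp: le_less_trans[OF _ ennreal_less_top])
  show "(\<integral>\<omega>. ?h \<omega> \<partial>M) \<le> \<sigma>\<^sup>2"
    using le unfolding nn_integral_eq_integral[OF int, simplified] by (simp add: ennreal_le_iff)
qed

text \<open>By Fubini the sample is integrated first, and at frozen weights the noise has mean zero.
  The hypothesis \<open>G2\<close> together with \<open>noise_square\<close> supplies the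
  integrability of the product.\<close>

lemma noise_uncorrelated:
  assumes t: "t < T" and G2: "integrable M (\<lambda>\<omega>. (norm (G t \<omega>))\<^sup>2)"
  shows "(\<integral>\<omega>. G t \<omega> \<bullet> noise (x t \<omega>) (W t \<omega>) \<partial>M) = 0"
proof -
  let ?P = "distr M borel (W t)" and ?J = "\<lambda>\<omega>. (W t \<omega>, x t \<omega>)"
  let ?q = "\<lambda>p. grad l (fst p) \<bullet> noise (snd p) (fst p)"
  have Wm: "W t \<in> borel_measurable M" and xm: "x t \<in> borel_measurable M"
    using t W_measurable x_measurable by auto
  interpret P: prob_space ?P
    by (rule prob_space_distr[OF Wm])
  interpret D: prob_space D
    by (rule D_prob)
  interpret pair_sigma_finite ?P D ..
  have Jm: "?J \<in> M \<rightarrow>\<^sub>M borel \<Otimes>\<^sub>M borel"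
    using Wm xm by (rule measurable_Pair)
  have q: "?q \<in> borel_measurable (borel \<Otimes>\<^sub>M borel)"
    by (intro borel_measurable_inner noise_measurable_pair measurable_compose[OF measurable_fst grad_l_measurable])
  have "integrable M (\<lambda>\<omega>. ?q (?J \<omega>))"
    using integrable_inner[OF G_measurable noise_measurable G2 noise_square(1)] t by simp
  then have "integrable (distr M (borel \<Otimes>\<^sub>M borel) ?J) ?q"
    using integrable_distr_eq[OF Jm q] by simp
  then have int: "integrable (?P \<Otimes>\<^sub>M D) ?q"
    unfolding joint_distr[OF t] .
  have "(\<integral>\<omega>. ?q (?J \<omega>) \<partial>M) = integral\<^sup>L (distr M (borel \<Otimes>\<^sub>M borel) ?J) ?q"
    by (rule integral_distr[OF Jm q, symmetric])
  also have "\<dots> = (\<integral>w. \<integral>z. ?q (w, z) \<partial>D \<partial>?P)"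
    unfolding joint_distr[OF t] by (rule integral_fst'[OF int, symmetric])
  also have "\<dots> = 0"
  proof -
    have "(\<integral>z. ?q (w, z) \<partial>D) = 0" for w
    proof -
      have "integrable D (\<lambda>z. noise z w)"
        unfolding noise_eq using noise_mean(1) by (intro Bochner_Integration.integrable_diff) auto
      moreover have "(\<integral>z. noise z w \<partial>D) = 0"
        unfolding noise_eq using noise_mean by (subst Bochner_Integration.integral_diff) (auto simp: D.prob_space)
      ultimately show ?thesis
        by simp
    qed
    then show ?thesis by simp
  qed
  finally show ?thesis by simp
qed

section \<open>Backward error\<close>

definition fwd_info :: "nat \<Rightarrow> 'a measure" where
  "fwd_info t = extend_sigma (fwd_sigma (past t) f W x \<delta> t N) {t} x"

lemma y_val_measurable: "t < T \<Longrightarrow> i \<le> N \<Longrightarrow> (\<lambda>\<omega>. y_val (W t \<omega>) (x t \<omega>) (d t \<omega>) i) \<in> borel_measurable M"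
  by (intro measurable_y_val W_measurable x_measurable) (auto intro: \<delta>_measurable)

lemma v_val_measurable:
  assumes "t < T" "i \<le> N" "1 \<le> i"
  shows "(\<lambda>\<omega>. v_val (W t \<omega>) (x t \<omega>) (d t \<omega>) (e t \<omega>) i) \<in> borel_measurable M"
    "(\<lambda>\<omega>. v_val (W t \<omega>) (x t \<omega>) (d t \<omega>) (\<lambda>_. 0) i) \<in> borel_measurable M"
  using assms by (auto intro!: measurable_v_val W_measurable x_measurable \<delta>_measurable \<epsilon>_measurable)

lemma fwd_info_subalgebra: "t < T \<Longrightarrow> subalgebra M (fwd_info t)"
  unfolding fwd_info_def fwd_sigma_def
  by (intro subalgebra_extend_sigma past_subalgebra) (auto intro: y_val_measurable x_measurable)

text \<open>All backward sigma-algebras extend the same base, so a vector known after the forward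
  pass is measurable for each of them and can be paired with the perturbation of any layer.\<close>

lemma bwd_sigma_eq:
  "bwd_sigma (past t) lay N f W x \<delta> \<epsilon> t i =
     extend_sigma (fwd_info t) {i..N} (\<lambda>k \<omega>. v_val (W t \<omega>) (x t \<omega>) (d t \<omega>) (e t \<omega>) k)"
  by (simp add: bwd_sigma_def fwd_info_def)

lemma bwd_sigma_subalgebra:
  "t < T \<Longrightarrow> 1 \<le> i \<Longrightarrow> subalgebra M (bwd_sigma (past t) lay N f W x \<delta> \<epsilon> t i)"
  unfolding bwd_sigma_eq by (intro subalgebra_extend_sigma fwd_info_subalgebra) (auto intro: v_val_measurable)

lemma W_measurable_fwd_info: "W t \<in> borel_measurable (fwd_info t)"
  by (rule measurable_from_subalg[OF _ W_measurable_past])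
    (auto simp: fwd_info_def fwd_sigma_def intro: subalgebra_trans subalgebra_extend_sigma_base)

lemma y_val_measurable_fwd_info:
  assumes "i \<le> N"
  shows "(\<lambda>\<omega>. y_val (W t \<omega>) (x t \<omega>) (d t \<omega>) i) \<in> borel_measurable (fwd_info t)"
\<comment> \<open>Layer 0 holds the sample itself; the generators of \<open>fwd_sigma\<close> start
  at layer 1, so it comes from the additional generator in \<open>fwd_info\<close>.\<close>
proof (cases "i = 0")
  case True
  then show ?thesis
    using measurable_extend_sigma[of t "{t}" x] by (simp add: fwd_info_def)
next
  case False
  then have "i \<in> {1..N}"
    using assms by simp
  from measurable_extend_sigma[OF this] show ?thesis
    unfolding fwd_info_def fwd_sigma_def
    by (rule measurable_from_subalg[OF subalgebra_extend_sigma_base])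
qed

abbreviation "dv t i \<omega> \<equiv> v_val (W t \<omega>) (x t \<omega>) (d t \<omega>) (e t \<omega>) i - v_val (W t \<omega>) (x t \<omega>) (d t \<omega>) (\<lambda>_. 0) i"

lemma sum_\<epsilon>_bound: "t < T \<Longrightarrow> AE \<omega> in M. (\<Sum>j\<in>{2..N}. norm (\<epsilon> t j \<omega>)) \<le> real N * \<bar>c\<bar>"
  using bounded unfolding perturbation_bound_def
proof eventually_elim
  case (elim \<omega>)
  then have "(\<Sum>j\<in>{2..N}. norm (\<epsilon> t j \<omega>)) \<le> (\<Sum>j\<in>{2..N}. \<bar>c\<bar>)"
    by (intro sum_mono) (auto intro: order.trans[OF _ abs_ge_self])
  also have "\<dots> \<le> real N * \<bar>c\<bar>"
    by (auto intro!: mult_right_mono)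
  finally show ?case .
qed

lemma integrable_inner_dv:
  assumes t: "t < T" and i: "i \<in> {1..N}" and Z: "Z \<in> borel_measurable M" "integrable M (\<lambda>\<omega>. norm (Z \<omega>))"
  shows "integrable M (\<lambda>\<omega>. Z \<omega> \<bullet> dv t i \<omega>)"
proof -
  obtain K where K: "0 \<le> K"
    "\<And>w z d e. norm (v_val w z d e i - v_val w z d (\<lambda>_. 0) i) \<le> K * (\<Sum>j\<in>{2..N}. norm (e j))"
    using v_val_backward_error[of i] i by auto
  show ?thesis
  proof (rule Bochner_Integration.integrable_bound)
    show "integrable M (\<lambda>\<omega>. norm (Z \<omega>) * (K * (real N * \<bar>c\<bar>)))"
      using Z by simp
    show "(\<lambda>\<omega>. Z \<omega> \<bullet> dv t i \<omega>) \<in> borel_measurable M"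
      using Z t i by (intro borel_measurable_inner borel_measurable_diff v_val_measurable) auto
    show "AE \<omega> in M. norm (Z \<omega> \<bullet> dv t i \<omega>) \<le> norm (norm (Z \<omega>) * (K * (real N * \<bar>c\<bar>)))"
      using sum_\<epsilon>_bound[OF t]
    proof eventually_elim
      case (elim \<omega>)
      have "norm (Z \<omega> \<bullet> dv t i \<omega>) \<le> norm (Z \<omega>) * norm (dv t i \<omega>)"
        by (simp add: Cauchy_Schwarz_ineq2)
      also have "\<dots> \<le> norm (Z \<omega>) * (K * (real N * \<bar>c\<bar>))"
        using K elim by (intro mult_left_mono order.trans[OF K(2)]) auto
      also have "\<dots> \<le> norm (norm (Z \<omega>) * (K * (real N * \<bar>c\<bar>)))"
        by simp
      finally show ?case .
    qed
  qed
qed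

text \<open>\<open>Z\<close> is known before the perturbation is added, so it can be pulled out of
  the conditional expectation. This is done coordinate by coordinate, the form in which centredness
  is given; boundedness of the perturbation makes the products integrable.\<close>

lemma \<epsilon>_centred:
  assumes t: "t < T" and i: "1 \<le> i" "i < N"
    and Z: "Z \<in> borel_measurable (fwd_info t)" "integrable M (\<lambda>\<omega>. norm (Z \<omega>))"
  shows "integrable M (\<lambda>\<omega>. Z \<omega> \<bullet> \<epsilon> t (Suc i) \<omega>)" "(\<integral>\<omega>. Z \<omega> \<bullet> \<epsilon> t (Suc i) \<omega> \<partial>M) = 0"
proof -
  let ?H = "bwd_sigma (past t) lay N f W x \<delta> \<epsilon> t (Suc i)"
  have H: "subalgebra M ?H"
    using t by (intro bwd_sigma_subalgebra) auto
  interpret H: finite_measure_subalgebra M ?H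
    by unfold_locales (rule H)
  have ZH: "(\<lambda>\<omega>. Z \<omega> $ j) \<in> borel_measurable ?H" for j
    unfolding bwd_sigma_eq
    by (intro borel_measurable_vec_nth measurable_from_subalg[OF subalgebra_extend_sigma_base Z(1)])
  have ZM: "(\<lambda>\<omega>. Z \<omega> $ j) \<in> borel_measurable M" for j
    by (rule measurable_from_subalg[OF H ZH])
  have \<epsilon>M: "(\<lambda>\<omega>. \<epsilon> t (Suc i) \<omega> $ j) \<in> borel_measurable M" for j
    using t i by (intro borel_measurable_vec_nth \<epsilon>_measurable) auto
  have zero: "AE \<omega> in M. real_cond_exp M ?H (\<lambda>\<omega>. \<epsilon> t (Suc i) \<omega> $ j) \<omega> = 0" for j
    using zero_mean t i unfolding zero_mean_perturbations_def cond_mean_zero_def by auto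
  have int: "integrable M (\<lambda>\<omega>. Z \<omega> $ j * \<epsilon> t (Suc i) \<omega> $ j)" for j
  proof (rule Bochner_Integration.integrable_bound)
    show "integrable M (\<lambda>\<omega>. norm (Z \<omega>) * \<bar>c\<bar>)"
      using Z by simp
    show "(\<lambda>\<omega>. Z \<omega> $ j * \<epsilon> t (Suc i) \<omega> $ j) \<in> borel_measurable M"
      using ZM \<epsilon>M by (rule borel_measurable_times)
    show "AE \<omega> in M. norm (Z \<omega> $ j * \<epsilon> t (Suc i) \<omega> $ j) \<le> norm (norm (Z \<omega>) * \<bar>c\<bar>)"
      using bounded unfolding perturbation_bound_def
    proof eventually_elim
      case (elim \<omega>)
      then have "norm (\<epsilon> t (Suc i) \<omega>) \<le> \<bar>c\<bar>"
        using t i by (auto intro: order.trans[OF _ abs_ge_self])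
      then have "\<bar>\<epsilon> t (Suc i) \<omega> $ j\<bar> \<le> \<bar>c\<bar>"
        by (rule order.trans[OF component_le_norm_cart])
      then show ?case
        by (auto simp: abs_mult intro!: mult_mono component_le_norm_cart)
    qed
  qed
  have "(\<integral>\<omega>. Z \<omega> $ j * \<epsilon> t (Suc i) \<omega> $ j \<partial>M) = 0" for j
  proof -
    have "(\<integral>\<omega>. Z \<omega> $ j * \<epsilon> t (Suc i) \<omega> $ j \<partial>M)
        = (\<integral>\<omega>. Z \<omega> $ j * real_cond_exp M ?H (\<lambda>\<omega>. \<epsilon> t (Suc i) \<omega> $ j) \<omega> \<partial>M)"
      by (rule H.real_cond_exp_intg(2)[OF int ZH \<epsilon>M, symmetric])
    also have "\<dots> = (\<integral>\<omega>. 0 \<partial>M)"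
      using zero[of j] ZM by (intro integral_cong_AE) auto
    finally show ?thesis by simp
  qed
  then show "integrable M (\<lambda>\<omega>. Z \<omega> \<bullet> \<epsilon> t (Suc i) \<omega>)" "(\<integral>\<omega>. Z \<omega> \<bullet> \<epsilon> t (Suc i) \<omega> \<partial>M) = 0"
    using int by (simp_all add: inner_vec_def)
qed

text \<open>
  The backward error solves a recursion that is linear in the backward perturbations and whose
  coefficients are determined by the forward pass, so it is uncorrelated with everything known
  after the forward pass.
\<close>

lemma dv_centred:
  assumes t: "t < T" and i: "i \<le> N" "1 \<le> i"
    and Z: "Z \<in> borel_measurable (fwd_info t)" "integrable M (\<lambda>\<omega>. norm (Z \<omega>))"
  shows "(\<integral>\<omega>. Z \<omega> \<bullet> dv t i \<omega> \<partial>M) = 0"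
  using i Z
proof (induction arbitrary: Z rule: inc_induct)
  case base
  show ?case by (simp add: v_val_last)
next
  case (step i)
  let ?J = "\<lambda>\<omega>. jac1 (f (Suc i)) (y_val (W t \<omega>) (x t \<omega>) (d t \<omega>) i) (W t \<omega>)"
  \<comment> \<open>Moving the transposed Jacobian across the inner product replaces
    \<open>Z\<close> by \<open>?Z\<close>, which is again known after the forward pass and
    integrable since the Jacobian is bounded. This is why the induction is over all
    \<open>Z\<close>.\<close>
  let ?Z = "\<lambda>\<omega>. ?J \<omega> *v Z \<omega>"
  have Jm: "?J \<in> borel_measurable (fwd_info t)"
    using step by (intro measurable_jac1 y_val_measurable_fwd_info W_measurable_fwd_info) auto
  have Zm: "?Z \<in> borel_measurable (fwd_info t)"
    by (rule borel_measurable_matrix_vector_mult[OF Jm step.prems(2)])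
  have ZM: "?Z \<in> borel_measurable M"
    by (rule measurable_from_subalg[OF fwd_info_subalgebra[OF t] Zm])
  have Zi: "integrable M (\<lambda>\<omega>. norm (?Z \<omega>))"
  proof (rule Bochner_Integration.integrable_bound)
    show "integrable M (\<lambda>\<omega>. C * norm (Z \<omega>))"
      using step.prems by simp
    have "norm (?Z \<omega>) \<le> C * norm (Z \<omega>)" for \<omega>
    proof -
      have "norm (?Z \<omega>) \<le> onorm (\<lambda>h. ?J \<omega> *v h) * norm (Z \<omega>)"
        by (rule onorm) simp
      also have "\<dots> \<le> C * norm (Z \<omega>)"
        using step by (intro mult_right_mono jac1_bound) auto
      finally show ?thesis .
    qed
    then show "AE \<omega> in M. norm (norm (?Z \<omega>)) \<le> norm (C * norm (Z \<omega>))"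
      by (intro always_eventually allI) (simp add: order.trans[OF _ abs_ge_self])
  qed (use ZM in measurable)
  have "Z \<omega> \<bullet> dv t i \<omega> = ?Z \<omega> \<bullet> dv t (Suc i) \<omega> + Z \<omega> \<bullet> \<epsilon> t (Suc i) \<omega>" for \<omega>
  proof -
    have "dv t i \<omega> = transpose (?J \<omega>) *v dv t (Suc i) \<omega> + \<epsilon> t (Suc i) \<omega>"
      using step by (simp add: v_val_step matrix_vector_mult_diff_distrib del: transpose_matrix_vector)
    then show ?thesis
      by (simp add: inner_add_right dot_lmul_matrix inner_commute[of "Z \<omega>"] inner_commute[of "?Z \<omega>"])
  qed
  then have "(\<integral>\<omega>. Z \<omega> \<bullet> dv t i \<omega> \<partial>M) = (\<integral>\<omega>. ?Z \<omega> \<bullet> dv t (Suc i) \<omega> + Z \<omega> \<bullet> \<epsilon> t (Suc i) \<omega> \<partial>M)"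
    by simp
  also have "\<dots> = (\<integral>\<omega>. ?Z \<omega> \<bullet> dv t (Suc i) \<omega> \<partial>M) + (\<integral>\<omega>. Z \<omega> \<bullet> \<epsilon> t (Suc i) \<omega> \<partial>M)"
    using step by (intro Bochner_Integration.integral_add integrable_inner_dv[OF t _ ZM Zi] \<epsilon>_centred[OF t]) auto
  also have "\<dots> = 0"
    using step.IH[OF _ Zm Zi] \<epsilon>_centred(2)[OF t _ _ step.prems(2,3)] step.prems step.hyps by simp
  finally show ?case .
qed

text \<open>Coordinate \<open>k\<close> of \<open>be\<close> is the inner product of column
  \<open>k\<close> of a weight Jacobian with the backward error of the block of \<open>k\<close>.
  Together with the gradient coordinate this column forms a vector known after the forward pass, so
  \<open>dv_centred\<close> applies to each summand.\<close>

lemma backward_error_uncorrelated: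
  assumes t: "t < T" and G2: "integrable M (\<lambda>\<omega>. (norm (G t \<omega>))\<^sup>2)"
  shows "(\<integral>\<omega>. G t \<omega> \<bullet> be t \<omega> \<partial>M) = 0"
proof -
  let ?J = "\<lambda>k \<omega>. jac2 (f (blk k)) (y_val (W t \<omega>) (x t \<omega>) (d t \<omega>) (blk k - 1)) (W t \<omega>)"
  let ?Z = "\<lambda>k \<omega>. G t \<omega> $ k *\<^sub>R (?J k \<omega> *v axis k 1)"
  have Gm: "G t \<in> borel_measurable (fwd_info t)"
    by (rule measurable_compose[OF W_measurable_fwd_info grad_l_measurable])
  have Zm: "?Z k \<in> borel_measurable (fwd_info t)" for k
  proof -
    have "blk k \<in> {1..N}" "blk k - 1 \<le> N"
      using blk_range[of k] by auto
    then show ?thesis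
      by (intro borel_measurable_scaleR borel_measurable_vec_nth Gm borel_measurable_matrix_vector_mult
          measurable_jac2 y_val_measurable_fwd_info W_measurable_fwd_info) auto
  qed
  have ZM: "?Z k \<in> borel_measurable M" for k
    by (rule measurable_from_subalg[OF fwd_info_subalgebra[OF t] Zm])
  have Zi: "integrable M (\<lambda>\<omega>. norm (?Z k \<omega>))" for k
  proof (rule Bochner_Integration.integrable_bound)
    \<comment> \<open>The known integrability concerns the squared norm of the gradient; adding 1
      makes it dominate the norm itself.\<close>
    show "integrable M (\<lambda>\<omega>. C * (1 + (norm (G t \<omega>))\<^sup>2))"
      using G2 by simp
    have "norm (?Z k \<omega>) \<le> C * (1 + (norm (G t \<omega>))\<^sup>2)" for \<omega>
    proof -
      have "norm (?J k \<omega> *v axis k 1) \<le> onorm (\<lambda>h. ?J k \<omega> *v h) * norm (axis k 1 :: real^'w)"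
        by (rule onorm) simp
      also have "\<dots> \<le> C"
        using jac2_bound[OF blk_range[of k]] by simp
      finally have J: "norm (?J k \<omega> *v axis k 1) \<le> C" .
      have "\<bar>G t \<omega> $ k\<bar> \<le> norm (G t \<omega>)"
        by (rule component_le_norm_cart)
      also have "\<dots> \<le> 1 + (norm (G t \<omega>))\<^sup>2"
        using sum_squares_bound[of 1 "norm (G t \<omega>)"] norm_ge_zero[of "G t \<omega>"] unfolding power_one mult_1_right
        by linarith
      finally have "\<bar>G t \<omega> $ k\<bar> \<le> 1 + (norm (G t \<omega>))\<^sup>2" .
      then have "\<bar>G t \<omega> $ k\<bar> * norm (?J k \<omega> *v axis k 1) \<le> (1 + (norm (G t \<omega>))\<^sup>2) * C"
        using J by (intro mult_mono) auto
      then show ?thesis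
        by (simp add: mult.commute)
    qed
    from order.trans[OF this abs_ge_self]
    show "AE \<omega> in M. norm (norm (?Z k \<omega>)) \<le> norm (C * (1 + (norm (G t \<omega>))\<^sup>2))"
      unfolding real_norm_def abs_norm_cancel by (rule always_eventually[OF allI])
  qed (use ZM in measurable)
  have "G t \<omega> \<bullet> be t \<omega> = (\<Sum>k\<in>UNIV. ?Z k \<omega> \<bullet> dv t (blk k) \<omega>)" for \<omega>
  proof -
    have "be t \<omega> $ k = (?J k \<omega> *v axis k 1) \<bullet> dv t (blk k) \<omega>" for k
    proof -
      have "be t \<omega> $ k = (transpose (?J k \<omega>) *v dv t (blk k) \<omega>) \<bullet> axis k 1"
        by (simp only: noisy_grad_def vector_minus_component vec_lambda_beta inner_axis
            vector_minus_component[symmetric] pgrad_backward_error) simp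
      also have "\<dots> = dv t (blk k) \<omega> \<bullet> (?J k \<omega> *v axis k 1)"
        unfolding transpose_matrix_vector dot_lmul_matrix ..
      finally show ?thesis
        by (simp only: inner_commute)
    qed
    then show ?thesis
      by (simp only: inner_vec_def[of "G t \<omega>"] inner_real_def inner_scaleR_left)
  qed
  then have "(\<integral>\<omega>. G t \<omega> \<bullet> be t \<omega> \<partial>M) = (\<integral>\<omega>. (\<Sum>k\<in>UNIV. ?Z k \<omega> \<bullet> dv t (blk k) \<omega>) \<partial>M)"
    by (simp only:)
  also have "\<dots> = (\<Sum>k\<in>UNIV. \<integral>\<omega>. ?Z k \<omega> \<bullet> dv t (blk k) \<omega> \<partial>M)"
    by (intro Bochner_Integration.integral_sum integrable_inner_dv[OF t blk_range ZM Zi])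
  also have "\<dots> = 0"
  proof (intro sum.neutral ballI)
    fix k
    show "(\<integral>\<omega>. ?Z k \<omega> \<bullet> dv t (blk k) \<omega> \<partial>M) = 0"
      using blk_range[of k] by (intro dv_centred[OF t _ _ Zm Zi]) auto
  qed
  finally show ?thesis .
qed

section \<open>Forward error\<close>

lemma sum_\<delta>_bound:
  "AE \<omega> in M. \<forall>t<T. (\<Sum>j\<in>{1..N}. norm (\<delta> t j \<omega>)) \<le> real N * \<bar>c\<bar>"
  using bounded unfolding perturbation_bound_def
proof eventually_elim
  case (elim \<omega>)
  show ?case
  proof (intro allI impI)
    fix t
    assume "t < T"
    with elim have "(\<Sum>j\<in>{1..N}. norm (\<delta> t j \<omega>)) \<le> (\<Sum>j\<in>{1..N}. \<bar>c\<bar>)"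
      by (intro sum_mono) (auto intro: order.trans[OF _ abs_ge_self])
    then show "(\<Sum>j\<in>{1..N}. norm (\<delta> t j \<omega>)) \<le> real N * \<bar>c\<bar>"
      by simp
  qed
qed

lemma fe_bound: "AE \<omega> in M. \<forall>t<T. norm (fe t \<omega>) \<le> Kf * (real N * \<bar>c\<bar>)"
  using sum_\<delta>_bound
proof eventually_elim
  case (elim \<omega>)
  then show ?case
    using Kf by (auto intro!: order.trans[OF forward_error] mult_left_mono)
qed

lemma be_bound:
  assumes "t < T"
  shows "AE \<omega> in M. norm (be t \<omega>) \<le> Kb * (real N * \<bar>c\<bar>)"
  using sum_\<epsilon>_bound[OF assms]
proof eventually_elim
  case (elim \<omega>)
  then show ?case
    using Kb by (auto intro!: order.trans[OF backward_error] mult_left_mono)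
qed

lemma fe_square_integrable: "t < T \<Longrightarrow> integrable M (\<lambda>\<omega>. (norm (fe t \<omega>))\<^sup>2)"
  by (rule integrable_AE_bounded[OF fe_measurable, where B = "Kf * (real N * \<bar>c\<bar>)"])
    (use fe_bound in \<open>auto elim!: eventually_mono\<close>)

lemma be_square_integrable: "t < T \<Longrightarrow> integrable M (\<lambda>\<omega>. (norm (be t \<omega>))\<^sup>2)"
  by (rule integrable_AE_bounded[OF be_measurable be_bound])

text \<open>One factor of each square is bounded by the worst case \<open>N * \<bar>c\<bar>\<close>,
  the other is summed along the path. That sum sees only the nonzero perturbations; in
  \<open>\<bar>c\<bar> * \<bar>c\<bar>\<close> one factor bounds their number and the other their
  size.\<close>

lemma sum_fe_square: "(\<Sum>t<T. \<integral>\<omega>. (norm (fe t \<omega>))\<^sup>2 \<partial>M) \<le> Kf\<^sup>2 * (real N * \<bar>c\<bar>) * (\<bar>c\<bar> * \<bar>c\<bar>)"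
proof -
  have "AE \<omega> in M. (\<Sum>t<T. (norm (fe t \<omega>))\<^sup>2) \<le> Kf\<^sup>2 * (real N * \<bar>c\<bar>) * (\<bar>c\<bar> * \<bar>c\<bar>)"
    using sum_\<delta>_bound few bounded[unfolded perturbation_bound_def]
  proof eventually_elim
    case (elim \<omega>)
    let ?S = "\<lambda>t. \<Sum>j\<in>{1..N}. norm (\<delta> t j \<omega>)"
    let ?A = "{(t, i). t < T \<and> i \<in> {1..N} \<and> \<delta> t i \<omega> \<noteq> 0}"
    have "(\<Sum>t<T. ?S t) = (\<Sum>p\<in>{..<T} \<times> {1..N}. norm (\<delta> (fst p) (snd p) \<omega>))"
      by (simp add: sum.cartesian_product case_prod_beta')
    also have "\<dots> = (\<Sum>p\<in>?A. norm (\<delta> (fst p) (snd p) \<omega>))"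
      by (rule sum.mono_neutral_right) auto
    also have "\<dots> \<le> (\<Sum>p\<in>?A. \<bar>c\<bar>)"
      using elim(3) by (intro sum_mono) (auto intro: order.trans[OF _ abs_ge_self])
    also have "\<dots> = real (occurrences {1..N} T \<delta> \<omega>) * \<bar>c\<bar>"
      by (simp add: occurrences_def)
    also have "\<dots> \<le> \<bar>c\<bar> * \<bar>c\<bar>"
      using elim(2) by (intro mult_right_mono) auto
    finally have S: "(\<Sum>t<T. ?S t) \<le> \<bar>c\<bar> * \<bar>c\<bar>" .
    have "(\<Sum>t<T. (norm (fe t \<omega>))\<^sup>2) \<le> (\<Sum>t<T. Kf\<^sup>2 * (real N * \<bar>c\<bar>) * ?S t)"
    proof (rule sum_mono)
      fix t
      assume t: "t \<in> {..<T}"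
      have "(norm (fe t \<omega>))\<^sup>2 \<le> (Kf * ?S t)\<^sup>2"
        by (intro power_mono forward_error norm_ge_zero)
      also have "\<dots> = Kf\<^sup>2 * (?S t * ?S t)"
        by (simp add: power2_eq_square)
      also have "\<dots> \<le> Kf\<^sup>2 * ((real N * \<bar>c\<bar>) * ?S t)"
        using elim(1) t by (intro mult_left_mono mult_right_mono sum_nonneg) auto
      finally show "(norm (fe t \<omega>))\<^sup>2 \<le> Kf\<^sup>2 * (real N * \<bar>c\<bar>) * ?S t"
        by (simp only: mult.assoc)
    qed
    also have "\<dots> = Kf\<^sup>2 * (real N * \<bar>c\<bar>) * (\<Sum>t<T. ?S t)"
      by (rule sum_distrib_left[symmetric])
    also have "\<dots> \<le> Kf\<^sup>2 * (real N * \<bar>c\<bar>) * (\<bar>c\<bar> * \<bar>c\<bar>)"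
      using S by (intro mult_left_mono) auto
    finally show ?case .
  qed
  then have "(\<integral>\<omega>. (\<Sum>t<T. (norm (fe t \<omega>))\<^sup>2) \<partial>M) \<le> (\<integral>\<omega>. Kf\<^sup>2 * (real N * \<bar>c\<bar>) * (\<bar>c\<bar> * \<bar>c\<bar>) \<partial>M)"
    by (intro integral_mono_AE Bochner_Integration.integrable_sum fe_square_integrable) auto
  then show ?thesis
    using fe_square_integrable by (subst (asm) Bochner_Integration.integral_sum) (auto simp: prob_space)
qed

section \<open>The recursion for the excess loss\<close>

lemma loss_step:
  assumes \<gamma>: "0 \<le> \<gamma>" "16 * L * \<gamma> \<le> 1" and t: "t < T"
  shows "l (W (Suc t) \<omega>) - lmin \<le> (1 - \<gamma> * \<mu> / 2) * (l (W t \<omega>) - lmin)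
      - \<gamma> * (G t \<omega> \<bullet> noise (x t \<omega>) (W t \<omega>)) - \<gamma> * (G t \<omega> \<bullet> be t \<omega>) + \<gamma> * (norm (fe t \<omega>))\<^sup>2
      + 4 * L * \<gamma>\<^sup>2 * ((norm (noise (x t \<omega>) (W t \<omega>)))\<^sup>2 + (norm (fe t \<omega>))\<^sup>2 + (norm (be t \<omega>))\<^sup>2)"
proof -
  define g n a b where "g = G t \<omega>" and "n = noise (x t \<omega>) (W t \<omega>)" and "a = fe t \<omega>" and "b = be t \<omega>"
  define P where "P = L * \<gamma>\<^sup>2"
  have L: "0 \<le> L"
    using l_lipschitz by (rule lipschitz_on_nonneg)
  have "W (Suc t) \<omega> = W t \<omega> + (- \<gamma> *\<^sub>R (g + n + a + b))"
    by (simp only: W_Suc g_def n_def a_def b_def scaleR_minus_left diff_conv_add_uminus)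
  then have "l (W (Suc t) \<omega>) \<le> l (W t \<omega>) + g \<bullet> (- \<gamma> *\<^sub>R (g + n + a + b)) + L * (norm (- \<gamma> *\<^sub>R (g + n + a + b)))\<^sup>2"
    using descent_lemma[OF l_diff l_lipschitz, of "W t \<omega>" "- \<gamma> *\<^sub>R (g + n + a + b)"] by (simp only: g_def)
  also have "(norm (- \<gamma> *\<^sub>R (g + n + a + b)))\<^sup>2 = \<gamma>\<^sup>2 * (norm (g + n + a + b))\<^sup>2"
    by (simp add: power_mult_distrib)
  also have "g \<bullet> (- \<gamma> *\<^sub>R (g + n + a + b)) = - \<gamma> * ((norm g)\<^sup>2 + g \<bullet> n + g \<bullet> a + g \<bullet> b)"
    by (simp add: inner_add_right power2_norm_eq_inner)
  finally have 1: "l (W (Suc t) \<omega>) \<le> l (W t \<omega>) - \<gamma> * (norm g)\<^sup>2 - \<gamma> * (g \<bullet> n) - \<gamma> * (g \<bullet> a) - \<gamma> * (g \<bullet> b)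
      + P * (norm (g + n + a + b))\<^sup>2"
    by (simp add: P_def algebra_simps)
  have "P * (norm (g + n + a + b))\<^sup>2 \<le> P * (4 * ((norm g)\<^sup>2 + (norm n)\<^sup>2 + (norm a)\<^sup>2 + (norm b)\<^sup>2))"
    unfolding P_def by (intro mult_left_mono norm_sum4_power2_le mult_nonneg_nonneg L) auto
  then have 2: "P * (norm (g + n + a + b))\<^sup>2
      \<le> 4 * (P * (norm g)\<^sup>2) + 4 * P * ((norm n)\<^sup>2 + (norm a)\<^sup>2 + (norm b)\<^sup>2)"
    by (simp add: algebra_simps)
  have "- (g \<bullet> a) \<le> norm g * norm a"
    using norm_cauchy_schwarz[of "- g" a] by simp
  then have "- (g \<bullet> a) \<le> (norm g)\<^sup>2 / 2 + (norm a)\<^sup>2 / 2"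
    using sum_squares_bound[of "norm g" "norm a"] by simp
  from mult_left_mono[OF this \<gamma>(1)]
  have 3: "- (\<gamma> * (g \<bullet> a)) \<le> \<gamma> * (norm g)\<^sup>2 / 2 + \<gamma> * (norm a)\<^sup>2 / 2"
    by (simp add: distrib_left)
  have "\<gamma> * (16 * L * \<gamma>) * (norm g)\<^sup>2 \<le> \<gamma> * 1 * (norm g)\<^sup>2"
    using \<gamma> by (intro mult_right_mono mult_left_mono) auto
  then have 4: "16 * (P * (norm g)\<^sup>2) \<le> \<gamma> * (norm g)\<^sup>2"
    by (simp add: P_def power2_eq_square ac_simps)
  have "\<gamma> * (2 * \<mu> * (l (W t \<omega>) - lmin)) \<le> \<gamma> * (norm g)\<^sup>2"
    unfolding g_def by (rule mult_left_mono[OF pl \<gamma>(1)])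
  then have 5: "\<gamma> * \<mu> / 2 * (l (W t \<omega>) - lmin) \<le> \<gamma> * (norm g)\<^sup>2 / 4"
    by simp
  \<comment> \<open>The budget of \<open>gg\<close>, which stands for \<gamma> times the squared
    gradient norm: one half absorbs the product with the forward error by Young's inequality, one
    quarter absorbs the gradient part of the quadratic term (the origin of the 16 in the step size
    condition), and the PL inequality turns the last quarter into the contraction
    \<open>\<gamma> * \<mu> / 2\<close>.\<close>
  have combine: "l' - lmin \<le> m - X - gn - gb + aa + V"
    if "l' \<le> m + lmin - gg - gn - ga - gb + Q" "Q \<le> 4 * Pg + V" "- ga \<le> gg / 2 + aa / 2" "16 * Pg \<le> gg"
      "X \<le> gg / 4" "0 \<le> aa"
    for l' m gg gn ga gb Q Pg V aa X :: real
    using that by linarith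
  have 6: "0 \<le> \<gamma> * (norm a)\<^sup>2"
    using \<gamma> by simp
  have "l (W (Suc t) \<omega>) - lmin \<le> (1 - \<gamma> * \<mu> / 2) * (l (W t \<omega>) - lmin)
      - \<gamma> * (g \<bullet> n) - \<gamma> * (g \<bullet> b) + \<gamma> * (norm a)\<^sup>2
      + 4 * P * ((norm n)\<^sup>2 + (norm a)\<^sup>2 + (norm b)\<^sup>2)"
    unfolding left_diff_distrib[of 1] mult_1
    by (rule combine[OF _ 2 3 4 5 6]) (use 1 in simp)
  then show ?thesis
    by (simp only: g_def n_def a_def b_def P_def mult.assoc)
qed

context
  assumes \<gamma>_nonneg: "0 \<le> \<gamma>" and \<gamma>_small: "16 * L * \<gamma> \<le> 1"
begin

text \<open>An integrable majorant for the next squared gradient; it is used only for integrability,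
  so its constants are crude.\<close>

lemma gradient_step:
  "(norm (G (Suc t) \<omega>))\<^sup>2 \<le> 4 * ((norm (G t \<omega>))\<^sup>2 + (L * \<gamma>)\<^sup>2 *
     (4 * ((norm (G t \<omega>))\<^sup>2 + (norm (noise (x t \<omega>) (W t \<omega>)))\<^sup>2 + (norm (fe t \<omega>))\<^sup>2 + (norm (be t \<omega>))\<^sup>2)))"
proof -
  let ?h = "G t \<omega> + noise (x t \<omega>) (W t \<omega>) + fe t \<omega> + be t \<omega>"
  have L: "0 \<le> L"
    using l_lipschitz by (rule lipschitz_on_nonneg)
  have "dist (W (Suc t) \<omega>) (W t \<omega>) = norm (- (\<gamma> *\<^sub>R ?h))"
    by (simp only: W_Suc dist_norm diff_conv_add_uminus add.commute[of "W t \<omega>"] add_minus_cancel add.assoc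
        right_minus add_0_right)
  then have "dist (W (Suc t) \<omega>) (W t \<omega>) = \<gamma> * norm ?h"
    using \<gamma>_nonneg by (simp only: norm_minus_cancel norm_scaleR abs_of_nonneg)
  then have "norm (G (Suc t) \<omega> - G t \<omega>) \<le> L * \<gamma> * norm ?h"
    using lipschitz_onD[OF l_lipschitz, of "W (Suc t) \<omega>" "W t \<omega>"] by (simp only: UNIV_I dist_norm mult.assoc)
  then have "(norm (G (Suc t) \<omega> - G t \<omega>))\<^sup>2 \<le> (L * \<gamma> * norm ?h)\<^sup>2"
    by (intro power_mono norm_ge_zero)
  also have "\<dots> \<le> (L * \<gamma>)\<^sup>2 * (4 * ((norm (G t \<omega>))\<^sup>2 + (norm (noise (x t \<omega>) (W t \<omega>)))\<^sup>2
      + (norm (fe t \<omega>))\<^sup>2 + (norm (be t \<omega>))\<^sup>2))"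
    unfolding power_mult_distrib[of "L * \<gamma>" "norm ?h"] by (intro mult_left_mono norm_sum4_power2_le) simp
  finally have diff: "(norm (G (Suc t) \<omega> - G t \<omega>))\<^sup>2 \<le> \<dots>" .
  have "(norm (G (Suc t) \<omega>))\<^sup>2 \<le> 4 * ((norm (G t \<omega>))\<^sup>2 + (norm (G (Suc t) \<omega> - G t \<omega>))\<^sup>2)"
    using norm_sum4_power2_le[of "G t \<omega>" "G (Suc t) \<omega> - G t \<omega>" 0 0] by simp
  with diff show ?thesis
    by argo
qed

lemma loss_bound_integrable:
  assumes "t < T" and "integrable M (\<lambda>\<omega>. (norm (G t \<omega>))\<^sup>2)" and "integrable M (\<lambda>\<omega>. l (W t \<omega>) - lmin)"
  shows "integrable M (\<lambda>\<omega>. (1 - \<gamma> * \<mu> / 2) * (l (W t \<omega>) - lmin)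
      - \<gamma> * (G t \<omega> \<bullet> noise (x t \<omega>) (W t \<omega>)) - \<gamma> * (G t \<omega> \<bullet> be t \<omega>) + \<gamma> * (norm (fe t \<omega>))\<^sup>2
      + 4 * L * \<gamma>\<^sup>2 * ((norm (noise (x t \<omega>) (W t \<omega>)))\<^sup>2 + (norm (fe t \<omega>))\<^sup>2 + (norm (be t \<omega>))\<^sup>2))"
proof -
  have "integrable M (\<lambda>\<omega>. l (W t \<omega>))"
    using Bochner_Integration.integrable_add[OF assms(3), of "\<lambda>_. lmin"] by simp
  with assms show ?thesis
    by (intro Bochner_Integration.integrable_add Bochner_Integration.integrable_diff integrable_mult_right
      integrable_inner G_measurable noise_measurable be_measurable noise_square fe_square_integrable
      be_square_integrable) auto
qed

text \<open>Both claims are needed together: the majorant of the next loss contains the present loss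
  as well as products with the gradient. For the loss an upper bound is enough, since the excess is
  nonnegative.\<close>

lemma square_integrable:
  "t \<le> T \<Longrightarrow> integrable M (\<lambda>\<omega>. (norm (G t \<omega>))\<^sup>2) \<and> integrable M (\<lambda>\<omega>. l (W t \<omega>) - lmin)"
proof (induction t)
  case 0
  then show ?case by (simp add: W_0)
next
  case (Suc t)
  then have t: "t < T" and G2: "integrable M (\<lambda>\<omega>. (norm (G t \<omega>))\<^sup>2)" and l: "integrable M (\<lambda>\<omega>. l (W t \<omega>) - lmin)"
    by auto
  have "integrable M (\<lambda>\<omega>. (norm (G (Suc t) \<omega>))\<^sup>2)"
  proof (rule Bochner_Integration.integrable_bound)
    show "integrable M (\<lambda>\<omega>. 4 * ((norm (G t \<omega>))\<^sup>2 + (L * \<gamma>)\<^sup>2 *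
        (4 * ((norm (G t \<omega>))\<^sup>2 + (norm (noise (x t \<omega>) (W t \<omega>)))\<^sup>2 + (norm (fe t \<omega>))\<^sup>2 + (norm (be t \<omega>))\<^sup>2))))"
      by (intro Bochner_Integration.integrable_add integrable_mult_right G2 noise_square(1)[OF t]
          fe_square_integrable[OF t] be_square_integrable[OF t])
    show "(\<lambda>\<omega>. (norm (G (Suc t) \<omega>))\<^sup>2) \<in> borel_measurable M"
      using G_measurable[OF Suc.prems] by measurable
  qed (intro always_eventually allI, unfold real_norm_def abs_power2, rule order.trans[OF gradient_step abs_ge_self])
  moreover have "integrable M (\<lambda>\<omega>. l (W (Suc t) \<omega>) - lmin)"
  proof (rule Bochner_Integration.integrable_bound[OF loss_bound_integrable[OF t G2 l]])
    show "(\<lambda>\<omega>. l (W (Suc t) \<omega>) - lmin) \<in> borel_measurable M"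
      by (intro borel_measurable_diff measurable_compose[OF W_measurable[OF Suc.prems] l_measurable]) simp
  qed (use lmin in \<open>intro always_eventually allI, unfold real_norm_def,
      simp only: abs_of_nonneg diff_ge_0_iff_ge order.trans[OF loss_step[OF \<gamma>_nonneg \<gamma>_small t] abs_ge_self]\<close>)
  ultimately show ?case ..
qed

text \<open>Second moments of the three errors in the quadratic term. Being multiplied by
  \<open>\<gamma>\<^sup>2\<close>, they may be taken at their worst case in every iteration.\<close>

definition error_var :: real where
  "error_var = \<sigma>\<^sup>2 + (Kf * (real N * \<bar>c\<bar>))\<^sup>2 + (Kb * (real N * \<bar>c\<bar>))\<^sup>2"

lemma expected_step:
  assumes t: "t < T"
  shows "(\<integral>\<omega>. (l (W (Suc t) \<omega>) - lmin) \<partial>M) \<le> (1 - \<gamma> * \<mu> / 2) * (\<integral>\<omega>. (l (W t \<omega>) - lmin) \<partial>M)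
    + \<gamma> * (\<integral>\<omega>. (norm (fe t \<omega>))\<^sup>2 \<partial>M) + 4 * L * \<gamma>\<^sup>2 * error_var"
proof -
  have G2: "integrable M (\<lambda>\<omega>. (norm (G t \<omega>))\<^sup>2)" and l: "integrable M (\<lambda>\<omega>. l (W t \<omega>) - lmin)"
    and l': "integrable M (\<lambda>\<omega>. l (W (Suc t) \<omega>) - lmin)"
    using square_integrable[of t] square_integrable[of "Suc t"] t by auto
  define gn gb and nn aa bb where "gn = (\<lambda>\<omega>. G t \<omega> \<bullet> noise (x t \<omega>) (W t \<omega>))" and "gb = (\<lambda>\<omega>. G t \<omega> \<bullet> be t \<omega>)"
    and "nn = (\<lambda>\<omega>. (norm (noise (x t \<omega>) (W t \<omega>)))\<^sup>2)" and "aa = (\<lambda>\<omega>. (norm (fe t \<omega>))\<^sup>2)" and "bb = (\<lambda>\<omega>. (norm (be t \<omega>))\<^sup>2)"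
  note defs = gn_def gb_def nn_def aa_def bb_def
  have int: "integrable M gn" "integrable M gb" "integrable M nn" "integrable M aa" "integrable M bb"
    unfolding defs using t
    by (intro integrable_inner G_measurable noise_measurable be_measurable noise_square fe_square_integrable
      be_square_integrable G2; simp)+
  have zero: "(\<integral>\<omega>. gn \<omega> \<partial>M) = 0" "(\<integral>\<omega>. gb \<omega> \<partial>M) = 0"
    unfolding defs by (intro noise_uncorrelated[OF t G2] backward_error_uncorrelated[OF t G2])+
  have nn: "(\<integral>\<omega>. nn \<omega> \<partial>M) \<le> \<sigma>\<^sup>2"
    unfolding defs by (rule noise_square(2)[OF t])
  have "AE \<omega> in M. aa \<omega> \<le> (Kf * (real N * \<bar>c\<bar>))\<^sup>2"
    using fe_bound unfolding defs by eventually_elim (use t in \<open>auto intro: power_mono\<close>)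
  then have aa: "(\<integral>\<omega>. aa \<omega> \<partial>M) \<le> (Kf * (real N * \<bar>c\<bar>))\<^sup>2"
    by (intro integral_le_const int)
  have "AE \<omega> in M. bb \<omega> \<le> (Kb * (real N * \<bar>c\<bar>))\<^sup>2"
    using be_bound[OF t] unfolding defs by eventually_elim (auto intro: power_mono)
  then have bb: "(\<integral>\<omega>. bb \<omega> \<partial>M) \<le> (Kb * (real N * \<bar>c\<bar>))\<^sup>2"
    by (intro integral_le_const int)
  have L: "0 \<le> L"
    using l_lipschitz by (rule lipschitz_on_nonneg)
  have "(\<integral>\<omega>. (l (W (Suc t) \<omega>) - lmin) \<partial>M) \<le> (\<integral>\<omega>. (1 - \<gamma> * \<mu> / 2) * (l (W t \<omega>) - lmin) - \<gamma> * gn \<omega> - \<gamma> * gb \<omega>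
      + \<gamma> * aa \<omega> + 4 * L * \<gamma>\<^sup>2 * (nn \<omega> + aa \<omega> + bb \<omega>) \<partial>M)"
    unfolding defs by (intro integral_mono l' loss_bound_integrable[OF t G2 l] loss_step[OF \<gamma>_nonneg \<gamma>_small t])
  also have "\<dots> = (1 - \<gamma> * \<mu> / 2) * (\<integral>\<omega>. (l (W t \<omega>) - lmin) \<partial>M) + \<gamma> * (\<integral>\<omega>. aa \<omega> \<partial>M)
      + 4 * L * \<gamma>\<^sup>2 * ((\<integral>\<omega>. nn \<omega> \<partial>M) + (\<integral>\<omega>. aa \<omega> \<partial>M) + (\<integral>\<omega>. bb \<omega> \<partial>M))"
    using int l zero
    by (simp add: Bochner_Integration.integral_add Bochner_Integration.integral_diff integral_mult_right_zero
        del: Bochner_Integration.integral_mult_right)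
  also have "\<dots> \<le> (1 - \<gamma> * \<mu> / 2) * (\<integral>\<omega>. (l (W t \<omega>) - lmin) \<partial>M) + \<gamma> * (\<integral>\<omega>. aa \<omega> \<partial>M) + 4 * L * \<gamma>\<^sup>2 * error_var"
    unfolding error_var_def using L by (intro add_left_mono mult_left_mono add_mono nn aa bb) auto
  finally show ?thesis
    unfolding aa_def .
qed

text \<open>Every error term keeps one factor \<gamma>: the bias because its squares have a bounded
  sum, the variance because a term of order \<open>\<gamma>\<^sup>2\<close> is divided by the
  contraction rate \<open>\<gamma> * \<mu> / 2\<close>.\<close>

lemma expected_loss_bound:
  assumes \<mu>: "0 < \<mu>" and \<gamma>: "0 < \<gamma>" "\<gamma> * \<mu> / 2 \<le> 1"
  shows "(\<integral>\<omega>. (l (W T \<omega>) - lmin) \<partial>M) \<le> (1 - \<gamma> * \<mu> / 2) ^ T * (l w0 - lmin)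
    + \<gamma> * (Kf\<^sup>2 * (real N * \<bar>c\<bar>) * (\<bar>c\<bar> * \<bar>c\<bar>)) + \<gamma> * (8 * L * error_var / \<mu>)"
proof -
  have L: "0 \<le> L"
    using l_lipschitz by (rule lipschitz_on_nonneg)
  have "0 \<le> 4 * L * \<gamma>\<^sup>2 * error_var"
    using L by (simp add: error_var_def)
  from linear_recursion_bound[of T "\<lambda>t. \<integral>\<omega>. (l (W t \<omega>) - lmin) \<partial>M" "\<gamma> * \<mu> / 2"
      "\<lambda>t. \<gamma> * (\<integral>\<omega>. (norm (fe t \<omega>))\<^sup>2 \<partial>M)", OF expected_step _ _ _ this order.refl]
  have "(\<integral>\<omega>. (l (W T \<omega>) - lmin) \<partial>M) \<le> (1 - \<gamma> * \<mu> / 2) ^ T * (\<integral>\<omega>. (l (W 0 \<omega>) - lmin) \<partial>M)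
      + (\<Sum>t<T. \<gamma> * (\<integral>\<omega>. (norm (fe t \<omega>))\<^sup>2 \<partial>M)) + 4 * L * \<gamma>\<^sup>2 * error_var / (\<gamma> * \<mu> / 2)"
    using \<mu> \<gamma> by (simp add: integral_nonneg)
  also have "(\<integral>\<omega>. (l (W 0 \<omega>) - lmin) \<partial>M) = l w0 - lmin"
    by (simp add: W_0 prob_space)
  also have "(\<Sum>t<T. \<gamma> * (\<integral>\<omega>. (norm (fe t \<omega>))\<^sup>2 \<partial>M)) \<le> \<gamma> * (Kf\<^sup>2 * (real N * \<bar>c\<bar>) * (\<bar>c\<bar> * \<bar>c\<bar>))"
    unfolding sum_distrib_left[symmetric] by (rule mult_left_mono[OF sum_fe_square \<gamma>_nonneg])
  also have "4 * L * \<gamma>\<^sup>2 * error_var / (\<gamma> * \<mu> / 2) = \<gamma> * (8 * L * error_var / \<mu>)"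
    using \<mu> \<gamma> by (simp add: field_simps power2_eq_square)
  finally show ?thesis
    by simp
qed

end

end

section \<open>The convergence rate\<close>

lemma one_minus_power_le_exp:
  fixes q :: real
  assumes "q \<le> 1"
  shows "(1 - q) ^ n \<le> exp (- (q * real n))"
proof -
  have "(1 - q) ^ n \<le> exp (- q) ^ n"
    using assms exp_ge_add_one_self[of "- q"] by (intro power_mono) auto
  also have "\<dots> = exp (- (q * real n))"
    by (simp add: exp_of_nat_mult[symmetric] mult.commute)
  finally show ?thesis .
qed

text \<open>The threshold 3 exceeds Euler's number, so the logarithm is at least 1 from there
  on.\<close>

lemma eventually_ln_over_n_le:
  assumes "0 < (b::real)"
  shows "\<exists>n0\<ge>3. \<forall>n\<ge>n0. ln (real n) / real n \<le> b"
proof -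
  have "((\<lambda>n. ln (real n) / real n) \<longlongrightarrow> 0) sequentially"
    by (rule filterlim_compose[OF ln_x_over_x_tendsto_0 filterlim_real_sequentially])
  from order_tendstoD(2)[OF this assms]
  obtain n0 where "\<And>n. n \<ge> n0 \<Longrightarrow> ln (real n) / real n < b"
    by (auto simp: eventually_sequentially)
  then show ?thesis
    by (intro exI[of _ "max 3 n0"]) (auto intro: less_imp_le)
qed

theorem corollary3:
  fixes N :: nat and d dw :: "nat \<Rightarrow> nat"
    and lay :: "'y::finite \<Rightarrow> nat" and blk :: "'w::finite \<Rightarrow> nat"
    and f :: "nat \<Rightarrow> real^'y \<Rightarrow> real^'w \<Rightarrow> real^'y"
    and R :: "real^'w \<Rightarrow> real" and D :: "(real^'y) measure"
    and w0 :: "real^'w" and loss :: "real^'y \<Rightarrow> real^'w \<Rightarrow> real"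
    and l :: "real^'w \<Rightarrow> real" and lmin :: real
  defines "loss \<equiv> sample_loss lay N f R"
    and "l \<equiv> expected_loss lay N f R D"
  assumes "N \<ge> 2"
    and "\<And>i. i \<le> N \<Longrightarrow> d i > 0" and "d N = 1" and "\<And>i. i \<in> {1..N} \<Longrightarrow> dw i > 0"
    and "index_blocks lay {0..N} d" and "index_blocks blk {1..N} dw"
    and "layered_operators lay blk N f"
    and "\<And>i. i \<in> {1..N} \<Longrightarrow> twice_differentiable (f i)"
    and "\<And>w. R differentiable (at w)"
    and "data_distribution lay D"
    and "\<And>w. integrable D (\<lambda>x. loss x w)"
    and "lmin \<in> range l" and "\<And>w. lmin \<le> l w"
    and "loss_smoothness l"
    and "stochasticity D loss l"
    and "operator_regularity N f"
    and "pl_condition l lmin"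
  shows "\<forall>c>0. \<exists>K>0. \<exists>T0::nat. \<exists>\<gamma>::nat \<Rightarrow> real. (\<forall>T. \<gamma> T > 0) \<and>
    (\<forall>T\<ge>T0. \<forall>(M::'a measure) x \<delta> \<epsilon>.
       let W = (\<lambda>t \<omega>. sgd lay blk N f R w0 (\<gamma> T)
                        (\<lambda>s. x s \<omega>) (\<lambda>s i. \<delta> s i \<omega>) (\<lambda>s i. \<epsilon> s i \<omega>) t)
       in sgd_randomness M D lay N T x \<delta> \<epsilon> \<and>
          zero_mean_perturbations M lay N f T W x \<delta> \<epsilon> \<and>
          perturbation_bound M N T \<delta> \<epsilon> c \<and>
          (AE \<omega> in M. real (occurrences {1..N} T \<delta> \<omega>) \<le> c) \<and>
          (AE \<omega> in M. real (occurrences {2..N} T \<epsilon> \<omega>) \<le> c * real T)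
          \<longrightarrow> integrable M (\<lambda>\<omega>. l (W T \<omega>) - lmin) \<and>
              (\<integral>\<omega>. (l (W T \<omega>) - lmin) \<partial>M) \<le> K * (ln (real T) / real T))"
proof (intro allI impI, goal_cases)
  case (1 c)
  obtain L where L: "0 < L" "L-lipschitz_on UNIV (grad l)" and l_diff: "\<And>w. l differentiable (at w)"
    using \<open>loss_smoothness l\<close> by (auto simp: loss_smoothness_def)
  obtain \<sigma> where \<sigma>: "\<And>w. integrable D (\<lambda>x. grad (loss x) w)"
      "\<And>w. (\<integral>x. grad (loss x) w \<partial>D) = grad l w"
      "\<And>w. integrable D (\<lambda>x. (norm (grad (loss x) w - grad l w))\<^sup>2)"
      "\<And>w. (\<integral>x. (norm (grad (loss x) w - grad l w))\<^sup>2 \<partial>D) \<le> \<sigma>\<^sup>2"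
    using \<open>stochasticity D loss l\<close> unfolding stochasticity_def by metis
  obtain \<mu> where \<mu>: "0 < \<mu>" "\<And>w. 2 * \<mu> * (l w - lmin) \<le> (norm (grad l w))\<^sup>2"
    using \<open>pl_condition l lmin\<close> by (auto simp: pl_condition_def)
  let ?regular = "\<lambda>C L0 L1. \<forall>i\<in>{1..N}. (\<forall>y w. onorm (\<lambda>h. jac1 (f i) y w *v h) \<le> C) \<and>
      (\<forall>y w. onorm (\<lambda>h. jac2 (f i) y w *v h) \<le> C) \<and>
      (\<forall>w. L0-lipschitz_on UNIV (\<lambda>y. f i y w)) \<and> (\<forall>w. L1-lipschitz_on UNIV (\<lambda>y. jac (f i) y w))"
  have "\<exists>C L0 L1. ?regular C L0 L1"
    using \<open>operator_regularity N f\<close> unfolding operator_regularity_def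
    by (elim exE conjE, intro exI ballI conjI) (drule (1) bspec, elim conjE, assumption)+
  then obtain C L0 L1 where reg: "?regular C L0 L1"
    by blast
  have "range blk \<subseteq> {1..N}"
    using \<open>index_blocks blk {1..N} dw\<close> by (simp add: index_blocks_def)
  then interpret net: network lay blk N f C L0 L1
    using \<open>layered_operators lay blk N f\<close> \<open>\<And>i. i \<in> {1..N} \<Longrightarrow> twice_differentiable (f i)\<close> reg
    by unfold_locales blast+
  \<comment> \<open>The error constants are fixed before the horizon, the probability space and the
    perturbations, since \<open>K\<close> may depend on none of these.\<close>
  obtain Kf where Kf: "0 \<le> Kf"
    "\<And>w z d. norm (net.g_val w z d (\<lambda>_. 0) - net.g_val w z (\<lambda>_. 0) (\<lambda>_. 0)) \<le> Kf * (\<Sum>j\<in>{1..N}. norm (d j))"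
    using net.g_val_forward_error by auto
  obtain Kb where Kb: "0 \<le> Kb"
    "\<And>w z d e. norm (net.g_val w z d e - net.g_val w z d (\<lambda>_. 0)) \<le> Kb * (\<Sum>j\<in>{2..N}. norm (e j))"
    using net.g_val_backward_error by auto
  \<comment> \<open>The bound 1 keeps the contraction factor nonnegative; the bound
    \<open>\<mu> / (32 * L)\<close> is the condition \<open>16 * L * \<gamma> \<le> 1\<close> after
    inserting the step size.\<close>
  obtain T0 where T0: "3 \<le> T0" "\<And>T. T0 \<le> T \<Longrightarrow> ln (real T) / real T \<le> min 1 (\<mu> / (32 * L))"
    using eventually_ln_over_n_le[of "min 1 (\<mu> / (32 * L))"] \<mu> L by auto
  \<comment> \<open>Below the threshold the value 1 only secures positivity.\<close>
  define \<gamma> where "\<gamma> T = (if T0 \<le> T then 2 / \<mu> * (ln (real T) / real T) else 1)" for T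
  define V where "V = \<sigma>\<^sup>2 + (Kf * (real N * \<bar>c\<bar>))\<^sup>2 + (Kb * (real N * \<bar>c\<bar>))\<^sup>2"
  define B where "B = Kf\<^sup>2 * (real N * \<bar>c\<bar>) * (\<bar>c\<bar> * \<bar>c\<bar>) + 8 * L * V / \<mu>"
  have V: "0 \<le> V"
    by (simp add: V_def)
  have B: "0 \<le> B"
    using L \<mu> V by (simp add: B_def)
  \<comment> \<open>The initial excess enters with weight 1 by the decay estimate,
    \<open>2 / \<mu> * B\<close> collects the terms with a factor \<gamma>, and the final 1 makes
    \<open>K\<close> positive even if both vanish.\<close>
  define K where "K = (l w0 - lmin) + 2 / \<mu> * B + 1"
  have lmin: "lmin \<le> l w" for w
    by fact
  have K: "0 < K"
    using lmin[of w0] B \<mu> unfolding K_def by (intro add_nonneg_pos add_nonneg_nonneg mult_nonneg_nonneg) auto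
  have ln_ge_1: "1 \<le> ln (real T)" if "T0 \<le> T" for T
  proof -
    have "exp 1 \<le> real T"
      using exp_le T0(1) that by linarith
    then show ?thesis
      using T0(1) that by (subst ln_ge_iff) auto
  qed
  have \<gamma>_pos: "0 < \<gamma> T" for T
    using ln_ge_1[of T] \<mu> T0(1) by (auto simp: \<gamma>_def intro!: mult_pos_pos divide_pos_pos)
  show ?case
  proof (rule exI[of _ K], rule conjI[OF K], rule exI[of _ T0], rule exI[of _ \<gamma>],
      intro conjI allI impI \<gamma>_pos, unfold Let_def, rule impI, elim conjE, rule conjI)
    fix T and M :: "'a measure" and x :: "nat \<Rightarrow> 'a \<Rightarrow> real^'y"
      and \<delta> \<epsilon> :: "nat \<Rightarrow> nat \<Rightarrow> 'a \<Rightarrow> real^'y"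
    let ?W = "\<lambda>t \<omega>. sgd lay blk N f R w0 (\<gamma> T) (\<lambda>s. x s \<omega>) (\<lambda>s i. \<delta> s i \<omega>) (\<lambda>s i. \<epsilon> s i \<omega>) t"
    assume T: "T0 \<le> T" and rand: "sgd_randomness M D lay N T x \<delta> \<epsilon>"
      and zero: "zero_mean_perturbations M lay N f T ?W x \<delta> \<epsilon>"
      and bounded: "perturbation_bound M N T \<delta> \<epsilon> c"
      and few: "AE \<omega> in M. real (occurrences {1..N} T \<delta> \<omega>) \<le> c"
    have M: "prob_space M"
      using rand by (simp add: sgd_randomness_def)
    have D: "prob_space D" "sets D = sets borel"
      using \<open>data_distribution lay D\<close> by (simp_all add: data_distribution_def)
    interpret P: sgd_process lay blk N f C L0 L1 M R D l w0 x \<delta> \<epsilon> ?W T "\<gamma> T" L \<sigma> \<mu> lmin Kf Kb c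
      by (intro sgd_process.intro net.network_axioms M sgd_process_axioms.intro)
        (fact \<open>\<And>w. R differentiable (at w)\<close> D l_diff L \<sigma>[unfolded loss_def] \<mu> lmin Kf Kb rand zero bounded few
          reflexive)+
    let ?r = "ln (real T) / real T"
    have \<gamma>: "\<gamma> T = 2 / \<mu> * ?r" and q: "\<gamma> T * \<mu> / 2 = ?r"
      using T \<mu> by (simp_all add: \<gamma>_def)
    have r: "?r \<le> 1" "?r \<le> \<mu> / (32 * L)"
      using T0(2)[OF T] by auto
    have small: "16 * L * \<gamma> T \<le> 1"
      using mult_left_mono[OF r(2), of "32 * L / \<mu>"] \<mu>(1) L(1) unfolding \<gamma> by simp
    note \<gamma>_nonneg = less_imp_le[OF \<gamma>_pos[of T]]
    show "integrable M (\<lambda>\<omega>. l (?W T \<omega>) - lmin)"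
      using P.square_integrable[OF \<gamma>_nonneg small order.refl] by blast
    have "(1 - ?r) ^ T \<le> exp (- (?r * real T))"
      by (rule one_minus_power_le_exp[OF r(1)])
    also have "\<dots> = 1 / real T"
      using T T0(1) by (simp add: exp_minus inverse_eq_divide)
    \<comment> \<open>Since the logarithm is at least 1, the decay 1/T is absorbed into the target
      rate.\<close>
    also have "\<dots> \<le> ?r"
      using ln_ge_1[OF T] by (intro divide_right_mono) auto
    finally have decay: "(1 - ?r) ^ T \<le> ?r" .
    have "(\<integral>\<omega>. (l (?W T \<omega>) - lmin) \<partial>M) \<le> (1 - ?r) ^ T * (l w0 - lmin) + \<gamma> T * B"
      using P.expected_loss_bound[OF \<gamma>_nonneg small \<mu>(1) \<gamma>_pos] r(1)
      unfolding P.error_var_def[OF \<gamma>_nonneg small] V_def[symmetric] q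
      by (simp add: B_def distrib_left)
    also have "\<dots> \<le> ?r * (l w0 - lmin) + \<gamma> T * B"
      using lmin[of w0] decay by (intro add_right_mono mult_right_mono) auto
    also have "\<dots> = (l w0 - lmin + 2 / \<mu> * B) * ?r"
      unfolding \<gamma> by (simp only: distrib_left distrib_right ac_simps)
    also have "\<dots> \<le> K * ?r"
      using ln_ge_1[OF T] by (intro mult_right_mono) (auto simp: K_def)
    finally show "(\<integral>\<omega>. (l (?W T \<omega>) - lmin) \<partial>M) \<le> K * ?r" .
  qed
qed

end
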